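(* Let $\Pi$ be a problem with derived problems $\Pi_1$ and $\Pi'_1$ (as in the context). Let $\mathcal G_{n,\Delta}$ be a $\Sigma$-input-labeled graph class of $n$-node graphs with maximum degree $\Delta$, assume $\mathcal G_{n,\Delta}$ is $t$-independent for some positive integer $t$ and contains only graphs of girth at least $2t+2$. Let $S\subseteq\mathbb N^+$ be a finite set of identifiers with $|S|\ge 4\Delta^{2t}$, and let $\mathcal G'_{n,\Delta}$ be the class of all input-labeled graphs obtained from a graph in $\mathcal G_{n,\Delta}$ by assigning unique identifiers from $S$ to its nodes (as additional input). Then the following are equivalent: (1) There is an order-invariant algorithm solving $\Pi$ on $\mathcal G'_{n,\Delta}$ in time $t$. (2) There is an order-invariant algorithm solving $\Pi_1$ on $\mathcal G'_{n,\Delta}$ in time $t-1$. (3) There is an order-invariant algorithm solving $\Pi'_1$ on $\mathcal G'_{n,\Delta}$ in time $t-1$.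
   Context: All graphs are simple, undirected and connected; $B(G)$ is the set of pairs $(v,e)$ with $v$ an endpoint of edge $e$. Multisets ignore order; $2^S$ is the power set. Input labels: a set $\Sigma$ with finite $\Sigma_{n,\Delta}\subseteq\Sigma$; a $\Sigma$-input-labeled graph ($n$ nodes, max degree $\Delta$) carries $\varphi_G:B(G)\to\Sigma_{n,\Delta}$. Problems: $\Pi=(\mathcal O,f,g,h)$ with $f(\Delta)\subseteq\mathcal O$ finite, $g(\Delta)$ a set of 2-element multisets over $f(\Delta)$, $h(\Delta)$ a set of multisets of at most $\Delta$ elements of $f(\Delta)$. An algorithm solves $\Pi$ on a class if on each graph of max degree $\Delta$ it outputs $o_{v,e}\in f(\Delta)$ at every $(v,e)\in B(G)$ such that $\{o_{u,e},o_{v,e}\}\in g(\Delta)$ for each edge $e=\{u,v\}$ and the multiset of outputs at each node lies in $h(\Delta)$. Model: port numbering model (nodes know $n,\Delta$, and their input labels per port; synchronous rounds, unbounded messages and computation); a $t$-round algorithm maps radius-$t$ neighborhoods (topology, ports, inputs) to one output per port. An algorithm on graphs with node identifiers is order-invariant if the output of each node depends only on the relative order of the identifiers it sees (and on the other input information), i.e., changing the identifiers in its view to other ones with the same relative order does not change its output. Neighborhoods: $N^t(v)$ = information $v$ gathers in $t$ rounds; $N^t(e)=N^t(u)\cap N^t(v)$; $\mathrm{ext}^t_e(v)=N^t(e)\setminus N^{t-1}(v)$; $\mathrm{ext}^t_v(e)=N^t(v)\setminus N^t(e)$. $t$-independence of $\mathcal G_{n,\Delta}$: for every $G$ in the class,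 node $v$, edge $e=\{u,v\}$: (i) any extension of $N^t_G(e)$ along $v$ realized in some graph of the class and any extension along $u$ realized in some graph of the class are realized simultaneously around one edge $e'$ of one graph $H$ of the class with $N^t_H(e')\cong N^t_G(e)$; (ii) for any choice, for every edge $e'$ incident to $v$, of an extension of $N^{t-1}_G(v)$ along $e'$ realized in some graph of the class, all chosen extensions are realized simultaneously at one node $w$ of one graph $H$ of the class with $N^{t-1}_H(w)\cong N^{t-1}_G(v)$. Derived problems: $\Pi_{1/2}$: $f_{1/2}(\Delta)=2^{f(\Delta)}$; $\{Y,Z\}\in g_{1/2}(\Delta)$ iff (P) $\{y,z\}\in g(\Delta)$ for all $y\in Y,z\in Z$; $\{Y_1,\dots,Y_i\}\in h_{1/2}(\Delta)$ ($i\le\Delta$) iff some $y_j\in Y_j$ give $\{y_1,\dots,y_i\}\in h(\Delta)$. $\Pi_1$: $f_1(\Delta)=2^{f_{1/2}(\Delta)}$; $\{Y,Z\}\in g_1(\Delta)$ iff some $y\in Y,z\in Z$ give $\{y,z\}\in g_{1/2}(\Delta)$; $\{Y_1,\dots,Y_i\}\in h_1(\Delta)$ iff (Q) $\{y_1,\dots,y_i\}\in h_{1/2}(\Delta)$ for all $y_j\in Y_j$. Simplified versions: $\Pi'_{1/2}$ is $\Pi_{1/2}$ with $g_{1/2}$ replaced by $g'_{1/2}(\Delta)$ = multisets satisfying (P) with $Y$ and $Z$ each inclusion-maximal subject to (P) (the other set fixed); $\Pi'_1$ is obtained from $\Pi'_{1/2}$ as $\Pi_1$ from $\Pi_{1/2}$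 (i.e., using $g'_{1/2}$ in the definition of $g_1$), with $h_1$ replaced by the multisets satisfying (Q) in which each $Y_j$ is inclusion-maximal subject to (Q) (others fixed). *)

theory Defs
  imports Main "HOL-Library.Multiset"
begin

section \<open>Problems and derived problems (at the level of a fixed maximum degree argument)\<close>

text \<open>A problem Pi = (O, f, g, h): the type 'o plays the role of O.\<close>
record 'o lcl_problem =
  outs  :: "nat \<Rightarrow> 'o set"            (* f *)
  edgec :: "nat \<Rightarrow> 'o multiset set"    (* g *)
  nodec :: "nat \<Rightarrow> 'o multiset set"    (* h *)

definition wf_problem :: "'o lcl_problem \<Rightarrow> bool" where
  "wf_problem P \<longleftrightarrow> (\<forall>D.
      finite (outs P D) \<and>
      (\<forall>M\<in>edgec P D. size M = 2 \<and> set_mset M \<subseteq> outs P D) \<and>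
      (\<forall>M\<in>nodec P D. size M \<le> D \<and> set_mset M \<subseteq> outs P D))"

text \<open>Property (P): all pairs are edge-compatible.\<close>
definition allcomp :: "'o lcl_problem \<Rightarrow> nat \<Rightarrow> 'o set \<Rightarrow> 'o set \<Rightarrow> bool" where
  "allcomp P D Y Z \<longleftrightarrow> (\<forall>y\<in>Y. \<forall>z\<in>Z. {#y, z#} \<in> edgec P D)"

text \<open>Pi_{1/2}\<close>
definition half :: "'o lcl_problem \<Rightarrow> 'o set lcl_problem" where
  "half P = \<lparr> outs = (\<lambda>D. Pow (outs P D)),
     edgec = (\<lambda>D. {M. \<exists>Y Z. M = {#Y, Z#} \<and> Y \<subseteq> outs P D \<and> Z \<subseteq> outs P D \<and> allcomp P D Y Z}),
     nodec = (\<lambda>D. {M. size M \<le> D \<and> set_mset M \<subseteq> Pow (outs P D) \<and>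
                     (\<exists>N\<in>nodec P D. rel_mset (\<lambda>Y y. y \<in> Y) M N)}) \<rparr>"

text \<open>Pi'_{1/2}: edge constraint restricted to pairs maximal w.r.t. (P).\<close>
definition half' :: "'o lcl_problem \<Rightarrow> 'o set lcl_problem" where
  "half' P = \<lparr> outs = (\<lambda>D. Pow (outs P D)),
     edgec = (\<lambda>D. {M. \<exists>Y Z. M = {#Y, Z#} \<and> Y \<subseteq> outs P D \<and> Z \<subseteq> outs P D \<and> allcomp P D Y Z
                    \<and> (\<forall>Y'. Y \<subset> Y' \<and> Y' \<subseteq> outs P D \<longrightarrow> \<not> allcomp P D Y' Z)
                    \<and> (\<forall>Z'. Z \<subset> Z' \<and> Z' \<subseteq> outs P D \<longrightarrow> \<not> allcomp P D Y Z')}),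
     nodec = nodec (half P) \<rparr>"

text \<open>Property (Q) for a multiset of sets w.r.t. a node constraint.\<close>
definition allnode :: "'o lcl_problem \<Rightarrow> nat \<Rightarrow> 'o set multiset \<Rightarrow> bool" where
  "allnode Q D M \<longleftrightarrow> (\<forall>N. rel_mset (\<lambda>Y y. y \<in> Y) M N \<longrightarrow> N \<in> nodec Q D)"

text \<open>Pi_1 obtained from Pi_{1/2} (the argument Q is Pi_{1/2} or Pi'_{1/2}).\<close>
definition one_from :: "'o lcl_problem \<Rightarrow> 'o set lcl_problem" where
  "one_from Q = \<lparr> outs = (\<lambda>D. Pow (outs Q D)),
     edgec = (\<lambda>D. {M. \<exists>Y Z. M = {#Y, Z#} \<and> Y \<subseteq> outs Q D \<and> Z \<subseteq> outs Q D \<and>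
                     (\<exists>y\<in>Y. \<exists>z\<in>Z. {#y, z#} \<in> edgec Q D)}),
     nodec = (\<lambda>D. {M. size M \<le> D \<and> set_mset M \<subseteq> Pow (outs Q D) \<and> allnode Q D M}) \<rparr>"

definition one :: "'o lcl_problem \<Rightarrow> 'o set set lcl_problem" where
  "one P = one_from (half P)"

text \<open>Pi'_1: from Pi'_{1/2}, with node constraint restricted to multisets whose
  elements are each inclusion-maximal subject to (Q) (others fixed).\<close>
definition one' :: "'o lcl_problem \<Rightarrow> 'o set set lcl_problem" where
  "one' P = \<lparr> outs = outs (one_from (half' P)),
     edgec = edgec (one_from (half' P)),
     nodec = (\<lambda>D. {M. M \<in> nodec (one_from (half' P)) D \<and>
                 (\<forall>Y\<in>#M. \<forall>Y'. Y \<subset> Y' \<and> Y' \<subseteq> outs (half' P) D \<longrightarrow>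
                      \<not> allnode (half' P) D (add_mset Y' (M - {#Y#})))}) \<rparr>"

section \<open>Port-numbered input-labeled graphs\<close>

text \<open>Node v has ports 0..<deg v; port i leads to neighbour nbr v i; the input label at
  (v, e) with e the edge behind port i is inp v i.\<close>
record ('v, 'l) pgraph =
  verts :: "'v set"
  deg   :: "'v \<Rightarrow> nat"
  nbr   :: "'v \<Rightarrow> nat \<Rightarrow> 'v"
  inp   :: "'v \<Rightarrow> nat \<Rightarrow> 'l"

definition adj :: "('v, 'l) pgraph \<Rightarrow> 'v \<Rightarrow> 'v \<Rightarrow> bool" where
  "adj G u v \<longleftrightarrow> (\<exists>i<deg G u. nbr G u i = v)"

text \<open>Port number at the other endpoint of the edge behind port i of v.\<close>
definition backport :: "('v, 'l) pgraph \<Rightarrow> 'v \<Rightarrow> nat \<Rightarrow> nat" where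
  "backport G v i = (SOME j. j < deg G (nbr G v i) \<and> nbr G (nbr G v i) j = v)"

text \<open>Simple, connected, port-numbered, Sigma-input-labeled graph with n nodes and
  maximum degree Delta.\<close>
definition in_graph_class :: "nat \<Rightarrow> nat \<Rightarrow> 'l set \<Rightarrow> ('v, 'l) pgraph \<Rightarrow> bool" where
  "in_graph_class n D Sig G \<longleftrightarrow>
     finite (verts G) \<and> card (verts G) = n \<and>
     (\<forall>v\<in>verts G. \<forall>i<deg G v. nbr G v i \<in> verts G \<and> nbr G v i \<noteq> v) \<and>
     (\<forall>v\<in>verts G. inj_on (nbr G v) {..<deg G v}) \<and>
     (\<forall>v\<in>verts G. \<forall>i<deg G v. adj G (nbr G v i) v) \<and>
     (\<forall>u\<in>verts G. \<forall>w\<in>verts G. (u, w) \<in> {(x, y). adj G x y}\<^sup>*) \<and>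
     (\<forall>v\<in>verts G. deg G v \<le> D) \<and> (\<exists>v\<in>verts G. deg G v = D) \<and>
     (\<forall>v\<in>verts G. \<forall>i<deg G v. inp G v i \<in> Sig)"

definition is_cycle :: "('v, 'l) pgraph \<Rightarrow> 'v list \<Rightarrow> bool" where
  "is_cycle G cs \<longleftrightarrow> length cs \<ge> 3 \<and> distinct cs \<and> set cs \<subseteq> verts G \<and>
     (\<forall>k<length cs. adj G (cs ! k) (cs ! ((k + 1) mod length cs)))"

definition girth_ge :: "('v, 'l) pgraph \<Rightarrow> nat \<Rightarrow> bool" where
  "girth_ge G m \<longleftrightarrow> (\<forall>cs. is_cycle G cs \<longrightarrow> length cs \<ge> m)"

section \<open>Views (information gathered in t rounds)\<close>

text \<open>A view: node label (identifier, or unit), input labels per port, and per port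
  either nothing (excluded direction / not yet explored) or the remote port number together
  with the view of the neighbour.  Depth-0 views have an empty child list.\<close>
datatype ('a, 'l) view = View 'a "'l list" "(nat \<times> ('a, 'l) view) option list"

text \<open>pview k G a v ex: radius-k view of v, not exploring through port ex.\<close>
primrec pview :: "nat \<Rightarrow> ('v, 'l) pgraph \<Rightarrow> ('v \<Rightarrow> 'a) \<Rightarrow> 'v \<Rightarrow> nat option \<Rightarrow> ('a, 'l) view" where
  "pview 0 G a v ex = View (a v) (map (inp G v) [0..<deg G v]) []"
| "pview (Suc k) G a v ex = View (a v) (map (inp G v) [0..<deg G v])
     (map (\<lambda>i. if ex = Some i then None
               else Some (backport G v i, pview k G a (nbr G v i) (Some (backport G v i))))
          [0..<deg G v])"

text \<open>N^t(v) for graphs without identifiers.\<close>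
definition nview :: "nat \<Rightarrow> ('v, 'l) pgraph \<Rightarrow> 'v \<Rightarrow> (unit, 'l) view" where
  "nview t G v = pview t G (\<lambda>_. ()) v None"

text \<open>N^t(e) for the edge e behind port i of v (oriented from v), = N^t(v) \<inter> N^t(u).\<close>
definition edge_view :: "nat \<Rightarrow> ('v, 'l) pgraph \<Rightarrow> 'v \<Rightarrow> nat \<Rightarrow>
    (unit, 'l) view \<times> nat \<times> nat \<times> (unit, 'l) view" where
  "edge_view t G v i = (pview (t - 1) G (\<lambda>_. ()) v (Some i), i, backport G v i,
      pview (t - 1) G (\<lambda>_. ()) (nbr G v i) (Some (backport G v i)))"

definition t_independent :: "('v, 'l) pgraph set \<Rightarrow> nat \<Rightarrow> bool" where
  "t_independent C t \<longleftrightarrow>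
    (\<forall>G\<in>C. \<forall>v\<in>verts G. \<forall>i<deg G v. \<forall>H1\<in>C. \<forall>v1\<in>verts H1. \<forall>H2\<in>C. \<forall>v2\<in>verts H2.
        i < deg H1 v1 \<and> edge_view t H1 v1 i = edge_view t G v i \<and>
        i < deg H2 v2 \<and> edge_view t H2 v2 i = edge_view t G v i \<longrightarrow>
        (\<exists>H\<in>C. \<exists>w\<in>verts H. i < deg H w \<and> edge_view t H w i = edge_view t G v i \<and>
            nview t H w = nview t H1 v1 \<and>
            nview t H (nbr H w i) = nview t H2 (nbr H2 v2 i))) \<and>
    (\<forall>G\<in>C. \<forall>v\<in>verts G. \<forall>(Hs :: nat \<Rightarrow> ('v, 'l) pgraph) (ws :: nat \<Rightarrow> 'v).
        (\<forall>i<deg G v. Hs i \<in> C \<and> ws i \<in> verts (Hs i) \<and> nview (t - 1) (Hs i) (ws i) = nview (t - 1) G v) \<longrightarrow>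
        (\<exists>H\<in>C. \<exists>w\<in>verts H. nview (t - 1) H w = nview (t - 1) G v \<and>
            (\<forall>i<deg G v. edge_view t H w i = edge_view t (Hs i) (ws i) i)))"

section \<open>Algorithms\<close>

text \<open>A t-round algorithm on graphs with identifiers: maps the radius-t view
  (with identifiers as node labels) and a port number to the output at that port.\<close>
definition order_invariant :: "((nat, 'l) view \<Rightarrow> nat \<Rightarrow> 'o) \<Rightarrow> bool" where
  "order_invariant A \<longleftrightarrow>
     (\<forall>V (\<sigma> :: nat \<Rightarrow> nat). strict_mono_on (set1_view V) \<sigma> \<longrightarrow> A (map_view \<sigma> id V) = A V)"

definition solves_on :: "'o lcl_problem \<Rightarrow> nat \<Rightarrow> ((nat, 'l) view \<Rightarrow> nat \<Rightarrow> 'o) \<Rightarrow> nat \<Rightarrow>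
    ('v, 'l) pgraph \<Rightarrow> ('v \<Rightarrow> nat) \<Rightarrow> bool" where
  "solves_on P D A t G idf \<longleftrightarrow>
     (let out = (\<lambda>v i. A (pview t G idf v None) i) in
       (\<forall>v\<in>verts G. \<forall>i<deg G v. out v i \<in> outs P D) \<and>
       (\<forall>v\<in>verts G. \<forall>i<deg G v. {# out v i, out (nbr G v i) (backport G v i) #} \<in> edgec P D) \<and>
       (\<forall>v\<in>verts G. mset (map (out v) [0..<deg G v]) \<in> nodec P D))"

text \<open>Solving on G': every graph of C with unique identifiers from S.\<close>
definition solves_with_ids :: "'o lcl_problem \<Rightarrow> nat \<Rightarrow> ((nat, 'l) view \<Rightarrow> nat \<Rightarrow> 'o) \<Rightarrow> nat \<Rightarrow>
    ('v, 'l) pgraph set \<Rightarrow> nat set \<Rightarrow> bool" where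
  "solves_with_ids P D A t C S \<longleftrightarrow>
     (\<forall>G\<in>C. \<forall>idf. inj_on idf (verts G) \<and> idf ` verts G \<subseteq> S \<longrightarrow> solves_on P D A t G idf)"

end

theory Submission
  imports Defs
begin

text \<open>
  An order-invariant algorithm is a function of order types of labelled neighbourhoods.  To save one
  round, an edge \<open>e\<close> collects all outputs that a \<open>t\<close>-round algorithm gives at its endpoints over the
  realizations of the order type of \<open>N\<^sup>t(e)\<close>, and a node collects these sets over the realizations
  of the order type of \<open>N\<^sup>t\<^sup>-\<^sup>1(v)\<close>.  The constraints of the derived problem hold because any two
  extensions of an edge neighbourhood, and any family of extensions of a node neighbourhood, occur
  in one common graph: independence supplies the unlabelled graph, the girth bound makes all nodes of
  the neighbourhoods distinct and the extensions disjoint outside their common part, so the linear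
  orders of the identifiers amalgamate and extend to an injective assignment from \<open>S\<close>.  Conversely,
  in one extra round the endpoints of an edge can agree on a compatible pair of sets, ties being
  broken by the identifiers.
\<close>

section \<open>Comparing and amalgamating linear orders\<close>

definition same_order :: "'v set \<Rightarrow> ('v \<Rightarrow> 'a::linorder) \<Rightarrow> ('v \<Rightarrow> 'b::linorder) \<Rightarrow> bool" where
  "same_order X f g \<longleftrightarrow> (\<forall>x\<in>X. \<forall>y\<in>X. f x < f y \<longleftrightarrow> g x < g y)"

lemma same_order_sym: "same_order X f g \<Longrightarrow> same_order X g f"
  by (auto simp: same_order_def)

lemma same_orderI:
  assumes "inj_on f X" and "\<And>x y. x \<in> X \<Longrightarrow> y \<in> X \<Longrightarrow> f x < f y \<Longrightarrow> g x < g y"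
  shows "same_order X f g"
  unfolding same_order_def
  using assms by (metis inj_onD linorder_neqE order_less_asym)

lemma same_order_le_iff:
  "same_order X f g \<Longrightarrow> x \<in> X \<Longrightarrow> y \<in> X \<Longrightarrow> f x \<le> f y \<longleftrightarrow> g x \<le> g y"
  unfolding same_order_def by (meson not_less)

lemma same_order_iff_strict_mono_comp:
  "same_order X f g \<longleftrightarrow> (\<exists>\<sigma>. strict_mono_on (f ` X) \<sigma> \<and> (\<forall>x\<in>X. g x = \<sigma> (f x)))"
proof
  assume same: "same_order X f g"
  define \<sigma> where "\<sigma> = g \<circ> inv_into X f"
  have \<sigma>: "g x = \<sigma> (f x)" if "x \<in> X" for x
  proof -
    have "inv_into X f (f x) \<in> X" "f (inv_into X f (f x)) = f x"
      using that by (auto intro: inv_into_into f_inv_into_f)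
    then show ?thesis
      using same that unfolding \<sigma>_def same_order_def comp_apply by (metis less_irrefl linorder_neqE)
  qed
  then have "strict_mono_on (f ` X) \<sigma>"
    using same by (auto simp: strict_mono_on_def same_order_def)
  then show "\<exists>\<sigma>. strict_mono_on (f ` X) \<sigma> \<and> (\<forall>x\<in>X. g x = \<sigma> (f x))"
    using \<sigma> by blast
next
  assume "\<exists>\<sigma>. strict_mono_on (f ` X) \<sigma> \<and> (\<forall>x\<in>X. g x = \<sigma> (f x))"
  then show "same_order X f g"
    unfolding same_order_def using strict_mono_on_less by fastforce
qed

lemma finite_acyclic_has_maximal:
  assumes "finite V" "V \<noteq> {}" "acyclic r"
  obtains m where "m \<in> V" "\<And>y. y \<in> V \<Longrightarrow> (m, y) \<notin> r"
proof -
  have "wf ((r \<inter> V \<times> V)\<inverse>)"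
    using assms(1) acyclic_subset[OF assms(3)] by (intro finite_acyclic_wf_converse) auto
  then obtain m where "m \<in> V" "\<And>y. (y, m) \<in> (r \<inter> V \<times> V)\<inverse> \<Longrightarrow> y \<notin> V"
    using wfE_min'[OF _ assms(2)] by blast
  then show thesis
    by (intro that) blast+
qed

lemma finite_linear_extension:
  fixes V :: "'v set" and S :: "'a::linorder set"
  assumes "finite V" "acyclic r" "finite S" "card V \<le> card S"
  obtains f where "inj_on f V" "f ` V \<subseteq> S"
    "\<And>x y. x \<in> V \<Longrightarrow> y \<in> V \<Longrightarrow> (x, y) \<in> r \<Longrightarrow> f x < f y"
proof -
  have "\<exists>f. inj_on f V \<and> f ` V \<subseteq> S \<and> (\<forall>x\<in>V. \<forall>y\<in>V. (x, y) \<in> r \<longrightarrow> f x < f y)"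
    using assms(1,3,4)
  proof (induction V arbitrary: S rule: finite_psubset_induct)
    case (psubset V)
    show ?case
    proof (cases "V = {}")
      case False
      obtain m where m: "m \<in> V" "\<And>y. y \<in> V \<Longrightarrow> (m, y) \<notin> r"
        using finite_acyclic_has_maximal[OF psubset.hyps False assms(2)] by blast
      have "S \<noteq> {}"
        using False psubset by auto
      define s where "s = Max S"
      have s: "s \<in> S" "\<And>x. x \<in> S \<Longrightarrow> x \<le> s"
        using psubset.prems(1) \<open>S \<noteq> {}\<close> by (simp_all add: s_def)
      have "V - {m} \<subset> V" "finite (S - {s})" "card (V - {m}) \<le> card (S - {s})"
        using psubset.prems m(1) s(1) by auto
      from psubset.IH[OF this] obtain f where f: "inj_on f (V - {m})" "f ` (V - {m}) \<subseteq> S - {s}"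
        "\<forall>x\<in>V - {m}. \<forall>y\<in>V - {m}. (x, y) \<in> r \<longrightarrow> f x < f y"
        by auto
      have below: "f x < s" if "x \<in> V" "x \<noteq> m" for x
        using f(2) s(2)[of "f x"] that by (fastforce simp: order_less_le)
      have "inj_on (f(m := s)) V"
        using f(1) below by (fastforce simp: inj_on_def)
      moreover have "(f(m := s)) ` V \<subseteq> S"
        using f(2) s(1) by auto
      moreover have "(f(m := s)) x < (f(m := s)) y" if "x \<in> V" "y \<in> V" "(x, y) \<in> r" for x y
        using f(3) m(2) below that by auto
      ultimately show ?thesis
        by blast
    qed simp
  qed
  then show thesis
    by (elim exE conjE) (rule that, auto)
qed

lemma card_below_mono:
  fixes a :: "'v \<Rightarrow> 'a::linorder"
  shows "finite Y \<Longrightarrow> a x \<le> a y \<Longrightarrow> card {b\<in>Y. a b \<le> a x} \<le> card {b\<in>Y. a b \<le> a y}"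
  by (intro card_mono) auto

lemma card_below_strict_mono:
  fixes a :: "'v \<Rightarrow> 'a::linorder"
  shows "finite Y \<Longrightarrow> y \<in> Y \<Longrightarrow> a x < a y \<Longrightarrow>
    card {b\<in>Y. a b \<le> a x} < card {b\<in>Y. a b \<le> a y}"
  by (intro psubset_card_mono) (auto simp: not_le[symmetric])

text \<open>The gap of \<open>x\<close> among the elements of the core, refined by the order within the gap, increases
  along each of the orders, so their union is acyclic.\<close>
lemma acyclic_sunflower_order:
  fixes a :: "'i \<Rightarrow> 'v \<Rightarrow> nat"
  assumes fin: "finite Y"
    and core: "\<And>i j. i \<in> I \<Longrightarrow> j \<in> I \<Longrightarrow> i \<noteq> j \<Longrightarrow> X i \<inter> X j \<subseteq> Y"
    and agree: "\<And>i j. i \<in> I \<Longrightarrow> j \<in> I \<Longrightarrow> i \<noteq> j \<Longrightarrow> same_order Y (a i) (a j)"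
  shows "acyclic {(x, y). \<exists>i\<in>I. x \<in> X i \<and> y \<in> X i \<and> a i x < a i y}"
proof -
  define petal where "petal x = (SOME i. i \<in> I \<and> x \<in> X i)" for x
  define gap where "gap i x = card {b\<in>Y. a i b \<le> a i x}" for i x
  define position where "position x = (if x \<in> Y then 0 else Suc (a (petal x) x))" for x
  have petal: "petal x \<in> I" "x \<in> X (petal x)" if "i \<in> I" "x \<in> X i" for i x
    using someI[of "\<lambda>i. i \<in> I \<and> x \<in> X i" i] that by (auto simp: petal_def)
  have petal_eq: "petal x = i" if "i \<in> I" "x \<in> X i" "x \<notin> Y" for i x
    using petal[OF that(1,2)] core that by blast
  have gap_petal: "gap (petal x) x = gap i x" if "i \<in> I" "x \<in> X i" for i x
  proof (cases "petal x = i \<or> x \<notin> Y")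
    case False
    then have "{b\<in>Y. a (petal x) b \<le> a (petal x) x} = {b\<in>Y. a i b \<le> a i x}"
      using same_order_le_iff[OF agree] petal(1)[OF that] that(1) by blast
    then show ?thesis
      by (simp add: gap_def)
  qed (use petal_eq that in auto)
  have "gap i x < gap i y \<or> gap i x = gap i y \<and> position x < position y"
    if "i \<in> I" "x \<in> X i" "y \<in> X i" "a i x < a i y" for i x y
  proof (cases "y \<in> Y")
    case True
    then show ?thesis
      unfolding gap_def using card_below_strict_mono[OF fin] that(4) by blast
  next
    case False
    then have "position x < position y"
      using petal_eq that by (auto simp: position_def)
    moreover have "gap i x \<le> gap i y"
      unfolding gap_def using that(4) by (intro card_below_mono[OF fin]) simp
    ultimately show ?thesis
      by auto
  qed
  then have "{(x, y). \<exists>i\<in>I. x \<in> X i \<and> y \<in> X i \<and> a i x < a i y}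
      \<subseteq> inv_image (less_than <*lex*> less_than) (\<lambda>x. (gap (petal x) x, position x))"
    using gap_petal by (fastforce simp: inv_image_def)
  then show ?thesis
    by (rule acyclic_subset[rotated]) (auto intro!: wf_acyclic)
qed

lemma amalgamate_sunflower_orders:
  fixes a :: "'i \<Rightarrow> 'v \<Rightarrow> nat" and S :: "'a::linorder set"
  assumes V: "finite V" "\<And>i. i \<in> I \<Longrightarrow> X i \<subseteq> V" "Y \<subseteq> V"
    and inj: "\<And>i. i \<in> I \<Longrightarrow> inj_on (a i) (X i)"
    and core: "\<And>i j. i \<in> I \<Longrightarrow> j \<in> I \<Longrightarrow> i \<noteq> j \<Longrightarrow> X i \<inter> X j \<subseteq> Y"
    and agree: "\<And>i j. i \<in> I \<Longrightarrow> j \<in> I \<Longrightarrow> i \<noteq> j \<Longrightarrow> same_order Y (a i) (a j)"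
    and S: "finite S" "card V \<le> card S"
  obtains b where "inj_on b V" "b ` V \<subseteq> S" "\<And>i. i \<in> I \<Longrightarrow> same_order (X i) (a i) b"
proof -
  have "acyclic {(x, y). \<exists>i\<in>I. x \<in> X i \<and> y \<in> X i \<and> a i x < a i y}"
    using acyclic_sunflower_order[OF finite_subset[OF V(3,1)] core agree] .
  from finite_linear_extension[OF V(1) this S] obtain b where b: "inj_on b V" "b ` V \<subseteq> S"
    "\<And>x y. x \<in> V \<Longrightarrow> y \<in> V \<Longrightarrow> \<exists>i\<in>I. x \<in> X i \<and> y \<in> X i \<and> a i x < a i y \<Longrightarrow> b x < b y"
    by auto
  show thesis
  proof
    show "same_order (X i) (a i) b" if "i \<in> I" for i
      using inj[OF that] by (rule same_orderI) (use b(3) V(2)[OF that] that in blast)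
  qed (use b in auto)
qed

lemma amalgamate_two_orders:
  fixes a\<^sub>1 a\<^sub>2 :: "'v \<Rightarrow> nat" and S :: "'a::linorder set"
  assumes "finite V" "X\<^sub>1 \<subseteq> V" "X\<^sub>2 \<subseteq> V" "inj_on a\<^sub>1 X\<^sub>1" "inj_on a\<^sub>2 X\<^sub>2"
    and "same_order (X\<^sub>1 \<inter> X\<^sub>2) a\<^sub>1 a\<^sub>2" "finite S" "card V \<le> card S"
  obtains b where "inj_on b V" "b ` V \<subseteq> S" "same_order X\<^sub>1 a\<^sub>1 b" "same_order X\<^sub>2 a\<^sub>2 b"
proof -
  have agree: "same_order (X\<^sub>1 \<inter> X\<^sub>2) (case_bool a\<^sub>1 a\<^sub>2 i) (case_bool a\<^sub>1 a\<^sub>2 j)"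
    if "i \<noteq> j" for i j
    using assms(6) same_order_sym that by (auto split: bool.split)
  obtain b where "inj_on b V" "b ` V \<subseteq> S"
    "\<And>i. same_order (case_bool X\<^sub>1 X\<^sub>2 i) (case_bool a\<^sub>1 a\<^sub>2 i) b"
    by (rule amalgamate_sunflower_orders[where I = UNIV and V = V and S = S and Y = "X\<^sub>1 \<inter> X\<^sub>2"
          and X = "case_bool X\<^sub>1 X\<^sub>2" and a = "case_bool a\<^sub>1 a\<^sub>2"])
      (use assms agree in \<open>auto split: bool.splits\<close>)
  from this(1,2) this(3)[of True] this(3)[of False] show thesis
    using that by simp
qed

section \<open>Relabelling views\<close>

fun labels :: "('a, 'l) view \<Rightarrow> 'a list" where
  "labels (View a ls cs) =
     a # concat (map (\<lambda>c. case c of None \<Rightarrow> [] | Some (j, U) \<Rightarrow> labels U) cs)"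

lemma set_labels: "set (labels V) = set1_view V"
proof (induction V rule: labels.induct[case_names View])
  case (View a ls cs)
  then show ?case
    by (fastforce simp: prod_set_defs split: option.splits)
qed

lemma labels_map_view: "labels (map_view f g V) = map f (labels V)"
proof (induction V rule: labels.induct[case_names View])
  case (View a ls cs)
  then show ?case
    by (auto simp: map_concat split: option.splits intro!: arg_cong[of _ _ concat])
qed

lemma distinct_labels_map_view_iff:
  "distinct (labels (map_view f g V)) \<longleftrightarrow> distinct (labels V) \<and> inj_on f (set1_view V)"
  by (simp add: labels_map_view distinct_map set_labels)

lemma map_view_eq_map_view_iff:
  "map_view f id V = map_view g id V \<longleftrightarrow> (\<forall>x\<in>set1_view V. f x = g x)"
proof
  assume "map_view f id V = map_view g id V"
  then have "map f (labels V) = map g (labels V)"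
    by (metis labels_map_view)
  then show "\<forall>x\<in>set1_view V. f x = g x"
    by (simp add: set_labels)
qed (auto intro: view.map_cong0)

text \<open>Views of the same shape are the two projections of one view of pairs.\<close>
lemma relabel_view:
  assumes shape: "map_view (\<lambda>_. ()) id V = map_view (\<lambda>_. ()) id W"
    and distinct: "distinct (labels V)" "distinct (labels W)"
  obtains \<rho> where "map_view \<rho> id V = W" "inj_on \<rho> (set1_view V)"
proof -
  have "rel_view (\<lambda>_ _. True) (=) V W"
    using shape by (simp add: view.rel_eq[symmetric] view.rel_map)
  then obtain Z where pairs: "set2_view Z \<subseteq> {(x, y). x = y}"
    and Z: "map_view fst fst Z = V" "map_view snd snd Z = W"
    by (auto simp: view.in_rel)
  have "inj_on fst (set1_view Z)"
    using distinct(1) by (auto simp: Z(1)[symmetric] distinct_labels_map_view_iff)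
  define \<rho> where "\<rho> = snd \<circ> inv_into (set1_view Z) fst"
  have "\<rho> (fst p) = snd p" if "p \<in> set1_view Z" for p
    using inv_into_f_f[OF \<open>inj_on fst (set1_view Z)\<close> that] by (simp add: \<rho>_def)
  then have "map_view \<rho> id V = W"
    using pairs by (auto simp: Z[symmetric] view.map_comp intro!: view.map_cong0)
  moreover from this have "inj_on \<rho> (set1_view V)"
    using distinct(2) distinct_labels_map_view_iff by metis
  ultimately show thesis
    using that by blast
qed

section \<open>Order types of views\<close>

definition order_equiv :: "(nat, 'l) view \<Rightarrow> (nat, 'l) view \<Rightarrow> bool" where
  "order_equiv V W \<longleftrightarrow> (\<exists>\<sigma>. strict_mono_on (set1_view V) \<sigma> \<and> map_view \<sigma> id V = W)"

lemma order_invariant_iff_order_equiv: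
  "order_invariant A \<longleftrightarrow> (\<forall>V W. order_equiv V W \<longrightarrow> A V = A W)"
  unfolding order_invariant_def order_equiv_def by metis

lemma order_equiv_map_view_iff:
  "order_equiv (map_view f id V) (map_view g id V) \<longleftrightarrow> same_order (set1_view V) f g"
  by (auto simp: order_equiv_def same_order_iff_strict_mono_comp view.set_map view.map_comp
      map_view_eq_map_view_iff)

lemma order_equiv_refl: "order_equiv V V"
  using order_equiv_map_view_iff[of id V id] by (simp add: view.map_id same_order_def)

lemma order_equiv_sym:
  assumes "order_equiv V W" shows "order_equiv W V"
proof -
  obtain \<sigma> where "map_view \<sigma> id V = W" "same_order (set1_view V) id \<sigma>"
    using assms order_equiv_map_view_iff[of id V] by (auto simp: order_equiv_def view.map_id)
  then show ?thesis
    using order_equiv_map_view_iff[of \<sigma> V id] by (simp add: view.map_id same_order_sym)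
qed

lemma order_equiv_trans:
  assumes "order_equiv U V" "order_equiv V W" shows "order_equiv U W"
proof -
  obtain \<sigma> \<tau> where "strict_mono_on (set1_view U) \<sigma>" "map_view \<sigma> id U = V"
    and "strict_mono_on (set1_view V) \<tau>" "map_view \<tau> id V = W"
    using assms by (auto simp: order_equiv_def)
  then have "strict_mono_on (set1_view U) (\<tau> \<circ> \<sigma>)" "map_view (\<tau> \<circ> \<sigma>) id U = W"
    by (auto simp: strict_mono_on_def view.set_map view.map_comp)
  then show ?thesis
    by (auto simp: order_equiv_def)
qed

lemma order_equiv_cong_left: "order_equiv V W \<Longrightarrow> order_equiv V U \<longleftrightarrow> order_equiv W U"
  using order_equiv_sym order_equiv_trans by blast

lemma order_equiv_transfer:
  assumes "order_equiv V V'" "set1_view W \<subseteq> set1_view V"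
    and "\<And>\<sigma>. map_view \<sigma> id V = V' \<Longrightarrow> map_view \<sigma> id W = W'"
  shows "order_equiv W W'"
proof -
  obtain \<sigma> where "strict_mono_on (set1_view V) \<sigma>" "map_view \<sigma> id V = V'"
    using assms(1) by (auto simp: order_equiv_def)
  then have "strict_mono_on (set1_view W) \<sigma>" "map_view \<sigma> id W = W'"
    using assms(2,3) by (auto simp: strict_mono_on_def)
  then show ?thesis
    by (auto simp: order_equiv_def)
qed

lemma order_equiv_imp_same_shape:
  "order_equiv V W \<Longrightarrow> map_view (\<lambda>_. ()) id V = map_view (\<lambda>_. ()) id W"
  by (auto simp: order_equiv_def view.map_comp comp_def id_def)

section \<open>Views in port-numbered graphs\<close>

lemma map_upt_eq_map_upt_iff:
  "map f [0..<m] = map g [0..<n] \<longleftrightarrow> m = n \<and> (\<forall>i<m. f i = g i)"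
  by (auto simp: list_eq_iff_nth_eq)

lemma pview_0_eq_iff:
  "pview 0 G a v ex = pview 0 G' a' v' ex' \<longleftrightarrow>
     a v = a' v' \<and> deg G v = deg G' v' \<and> (\<forall>i<deg G v. inp G v i = inp G' v' i)"
  by (auto simp: map_upt_eq_map_upt_iff)

lemma pview_Suc_eq_iff:
  "pview (Suc k) G a v ex = pview (Suc k) G' a' v' ex \<longleftrightarrow>
     a v = a' v' \<and> deg G v = deg G' v' \<and> (\<forall>i<deg G v. inp G v i = inp G' v' i) \<and>
     (\<forall>i<deg G v. ex \<noteq> Some i \<longrightarrow> backport G v i = backport G' v' i \<and>
        pview k G a (nbr G v i) (Some (backport G v i)) =
        pview k G' a' (nbr G' v' i) (Some (backport G v i)))"
  by (auto simp: map_upt_eq_map_upt_iff)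

lemma map_view_pview: "map_view f id (pview k G a v ex) = pview k G (f \<circ> a) v ex"
  by (induction k arbitrary: v ex) auto

lemma pview_eq_map_view_pview_ident: "pview k G a v ex = map_view a id (pview k G (\<lambda>x. x) v ex)"
  by (simp add: map_view_pview comp_def)

definition pview_verts :: "nat \<Rightarrow> ('v, 'l) pgraph \<Rightarrow> 'v \<Rightarrow> nat option \<Rightarrow> 'v set" where
  "pview_verts k G v ex = set1_view (pview k G (\<lambda>x. x) v ex)"

lemma pview_verts_0 [simp]: "pview_verts 0 G v ex = {v}"
  by (simp add: pview_verts_def)

lemma pview_verts_Suc:
  "pview_verts (Suc k) G v ex = insert v (\<Union>i\<in>{i. i < deg G v \<and> ex \<noteq> Some i}.
     pview_verts k G (nbr G v i) (Some (backport G v i)))"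
  by (auto simp: pview_verts_def prod_set_defs split: if_splits)

declare pview.simps(2) [simp del]

lemma pview_eq_imp_deg_eq: "pview k G a v ex = pview k G' a' v' ex \<Longrightarrow> deg G v = deg G' v'"
  by (cases k) (auto simp: pview_0_eq_iff pview_Suc_eq_iff simp del: pview.simps)

lemma pview_eq_imp_root_eq: "pview k G a v ex = pview k G' a' v' ex \<Longrightarrow> a v = a' v'"
  by (cases k) (auto simp: pview.simps)

lemma pview_eq_of_pview_Suc_eq:
  "pview (Suc k) G a v ex = pview (Suc k) G' a' v' ex \<Longrightarrow> pview k G a v ex = pview k G' a' v' ex"
proof (induction k arbitrary: v v' ex)
  case 0
  then show ?case
    unfolding pview_0_eq_iff pview_Suc_eq_iff by blast
next
  case (Suc k)
  then show ?case
    unfolding pview_Suc_eq_iff[of "Suc k" G a v] pview_Suc_eq_iff[of k G a v] by blast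
qed

lemma pview_Some_eq_of_pview_None_eq:
  assumes "pview k G a v None = pview k G' a' v' None"
  shows "pview k G a v (Some i) = pview k G' a' v' (Some i)"
proof (cases k)
  case (Suc m)
  then show ?thesis
    using assms unfolding Suc pview_Suc_eq_iff by blast
qed (use assms in simp)

lemma root_in_pview_verts: "v \<in> pview_verts k G v ex"
  by (cases k) (auto simp: pview_verts_Suc)

lemma pview_verts_subset_Suc: "pview_verts k G v ex \<subseteq> pview_verts (Suc k) G v ex"
proof (induction k arbitrary: v ex)
  case (Suc k)
  show ?case
    unfolding pview_verts_Suc[of k G v] pview_verts_Suc[of "Suc k" G v]
    by (intro insert_mono UN_mono Suc.IH) simp
qed (simp add: root_in_pview_verts)

lemma pview_verts_subset_None: "pview_verts k G v ex \<subseteq> pview_verts k G v None"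
  by (cases k) (auto simp: pview_verts_Suc)

lemma pview_verts_Suc_None:
  assumes "i < deg G v"
  shows "pview_verts (Suc k) G v None =
    pview_verts (Suc k) G v (Some i) \<union> pview_verts k G (nbr G v i) (Some (backport G v i))"
  using assms by (auto simp: pview_verts_Suc)

lemma set1_view_pview: "set1_view (pview k G a v ex) = a ` pview_verts k G v ex"
  by (subst pview_eq_map_view_pview_ident) (simp add: pview_verts_def view.set_map)

lemma order_equiv_pview_iff:
  "order_equiv (pview k G f v ex) (pview k G g v ex) \<longleftrightarrow> same_order (pview_verts k G v ex) f g"
  unfolding pview_verts_def order_equiv_map_view_iff[symmetric]
  by (simp add: map_view_pview comp_def)

definition join_views :: "('a, 'l) view \<Rightarrow> nat \<Rightarrow> ('a, 'l) view \<Rightarrow> ('a, 'l) view" where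
  "join_views V j U = (case V of View a ls cs \<Rightarrow> View a ls (cs @ [Some (j, U)]))"

lemma join_views_eq_iff [simp]:
  "join_views V j U = join_views V' j' U' \<longleftrightarrow> V = V' \<and> j = j' \<and> U = U'"
  by (cases V; cases V') (auto simp: join_views_def)

lemma map_view_join_views [simp]:
  "map_view f g (join_views V j U) = join_views (map_view f g V) j (map_view f g U)"
  by (cases V) (simp add: join_views_def)

lemma set1_view_join_views [simp]:
  "set1_view (join_views V j U) = set1_view V \<union> set1_view U"
  by (cases V) (auto simp: join_views_def prod_set_defs)

lemma labels_join_views [simp]: "labels (join_views V j U) = labels V @ labels U"
  by (cases V) (simp add: join_views_def)

text \<open>The neighbourhood \<open>N\<^sup>k\<^sup>+\<^sup>1(e)\<close> of the edge \<open>e\<close> behind port \<open>i\<close> of \<open>v\<close>, with node labels \<open>a\<close>,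
  packed into a single view so that \<^const>\<open>order_equiv\<close> and \<^const>\<open>labels\<close> apply to it.\<close>
definition epview :: "nat \<Rightarrow> ('v, 'l) pgraph \<Rightarrow> ('v \<Rightarrow> 'a) \<Rightarrow> 'v \<Rightarrow> nat \<Rightarrow> ('a, 'l) view" where
  "epview k G a v i = join_views (pview k G a v (Some i)) (backport G v i)
     (pview k G a (nbr G v i) (Some (backport G v i)))"

definition epview_verts :: "nat \<Rightarrow> ('v, 'l) pgraph \<Rightarrow> 'v \<Rightarrow> nat \<Rightarrow> 'v set" where
  "epview_verts k G v i =
     pview_verts k G v (Some i) \<union> pview_verts k G (nbr G v i) (Some (backport G v i))"

lemma map_view_epview: "map_view f id (epview k G a v i) = epview k G (f \<circ> a) v i"
  by (simp add: epview_def map_view_pview)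

lemma set1_view_epview: "set1_view (epview k G a v i) = a ` epview_verts k G v i"
  by (simp add: epview_def epview_verts_def set1_view_pview image_Un)

lemma order_equiv_epview_iff:
  "order_equiv (epview k G f v i) (epview k G g v i) \<longleftrightarrow> same_order (epview_verts k G v i) f g"
  using order_equiv_map_view_iff[of f "epview k G (\<lambda>x. x) v i" g]
  by (simp add: map_view_epview comp_def set1_view_epview)

lemma edge_view_Suc_eq_iff:
  "edge_view (Suc k) G v i = edge_view (Suc k) G' v' i \<longleftrightarrow>
     epview k G (\<lambda>_. ()) v i = epview k G' (\<lambda>_. ()) v' i"
  by (auto simp: edge_view_def epview_def)

lemma epview_verts_subset_pview_verts:
  "i < deg G v \<Longrightarrow> epview_verts k G v i \<subseteq> pview_verts (Suc k) G v None"
  using pview_verts_subset_Suc[of k G v "Some i"] pview_verts_Suc_None[of i G v k]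
  by (auto simp: epview_verts_def)

lemma pview_verts_subset_epview_verts: "pview_verts k G v None \<subseteq> epview_verts k G v i"
proof (cases k)
  case (Suc m)
  have "pview_verts m G (nbr G v l) (Some (backport G v l)) \<subseteq> epview_verts k G v i"
    if "l < deg G v" for l
    using that pview_verts_subset_Suc[of m G "nbr G v i"]
    by (cases "l = i") (auto simp: epview_verts_def Suc pview_verts_Suc[of m G v])
  then show ?thesis
    using root_in_pview_verts[of v k G "Some i"]
    by (auto simp: Suc pview_verts_Suc[of m G v None] epview_verts_def)
qed (simp add: epview_verts_def)

lemma epview_eq_of_pview_eq:
  assumes "pview (Suc k) G a v None = pview (Suc k) G' a' v' None" "i < deg G v"
  shows "epview k G a v i = epview k G' a' v' i"
proof -
  have "pview k G a v (Some i) = pview k G' a' v' (Some i)"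
    using assms(1) by (rule pview_eq_of_pview_Suc_eq[OF pview_Some_eq_of_pview_None_eq])
  then show ?thesis
    using assms by (auto simp: epview_def pview_Suc_eq_iff)
qed

lemma pview_eq_of_epview_eq:
  assumes "epview k G a v i = epview k G' a' v' i"
  shows "pview k G a v None = pview k G' a' v' None"
proof (cases k)
  case 0
  then show ?thesis using assms by (simp add: epview_def)
next
  case (Suc m)
  have port: "backport G v i = backport G' v' i"
    and near: "pview (Suc m) G a v (Some i) = pview (Suc m) G' a' v' (Some i)"
    and far: "pview (Suc m) G a (nbr G v i) (Some (backport G v i)) =
      pview (Suc m) G' a' (nbr G' v' i) (Some (backport G v i))"
    using assms by (auto simp: epview_def Suc)
  from pview_eq_of_pview_Suc_eq[OF far] port near show ?thesis
    unfolding Suc pview_Suc_eq_iff by auto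
qed

lemma order_equiv_epview_of_pview:
  assumes "order_equiv (pview (Suc k) G a v None) (pview (Suc k) G' a' v' None)" "i < deg G v"
  shows "order_equiv (epview k G a v i) (epview k G' a' v' i)"
  using assms(1)
proof (rule order_equiv_transfer)
  show "set1_view (epview k G a v i) \<subseteq> set1_view (pview (Suc k) G a v None)"
    using epview_verts_subset_pview_verts[OF assms(2)]
    by (auto simp: set1_view_epview set1_view_pview)
qed (use epview_eq_of_pview_eq assms(2) in \<open>simp add: map_view_pview map_view_epview\<close>)

lemma order_equiv_pview_of_epview:
  assumes "order_equiv (epview k G a v i) (epview k G' a' v' i)"
  shows "order_equiv (pview k G a v None) (pview k G' a' v' None)"
  using assms
proof (rule order_equiv_transfer)
  show "set1_view (pview k G a v None) \<subseteq> set1_view (epview k G a v i)"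
    using pview_verts_subset_epview_verts[of k G v i]
    by (auto simp: set1_view_epview set1_view_pview)
qed (use pview_eq_of_epview_eq in \<open>simp add: map_view_pview map_view_epview\<close>)

lemma nview_eq_of_order_equiv:
  assumes "order_equiv (pview k G a v None) (pview k G' a' v' None)"
  shows "nview k G v = nview k G' v'"
  using order_equiv_imp_same_shape[OF assms] by (simp add: nview_def map_view_pview comp_def)

lemma deg_eq_of_order_equiv:
  assumes "order_equiv (pview k G a v None) (pview k G' a' v' None)"
  shows "deg G v = deg G' v'"
  using nview_eq_of_order_equiv[OF assms] unfolding nview_def by (rule pview_eq_imp_deg_eq)

lemma backport_eq_of_order_equiv:
  assumes "order_equiv (epview k G a v i) (epview k G' a' v' i)"
  shows "backport G v i = backport G' v' i"
  using order_equiv_imp_same_shape[OF assms] by (simp add: epview_def)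

lemma endpoint_less_iff_of_order_equiv:
  assumes "order_equiv (epview k G a v i) (epview k G' a' v' i)"
  shows "a v < a (nbr G v i) \<longleftrightarrow> a' v' < a' (nbr G' v' i)"
proof -
  obtain \<sigma> where \<sigma>: "strict_mono_on (a ` epview_verts k G v i) \<sigma>"
      and "epview k G (\<sigma> \<circ> a) v i = epview k G' a' v' i"
    using assms by (auto simp: order_equiv_def map_view_epview set1_view_epview)
  then have "a' v' = \<sigma> (a v)" "a' (nbr G' v' i) = \<sigma> (a (nbr G v i))"
    by (auto simp: epview_def dest!: pview_eq_imp_root_eq)
  then show ?thesis
    using strict_mono_on_less[OF \<sigma>] by (auto simp: epview_verts_def root_in_pview_verts)
qed

section \<open>Girth and the tree-likeness of views\<close>

locale port_graph =
  fixes G :: "('v, 'l) pgraph"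
  assumes nbr_in_verts: "v \<in> verts G \<Longrightarrow> i < deg G v \<Longrightarrow> nbr G v i \<in> verts G"
    and nbr_neq: "v \<in> verts G \<Longrightarrow> i < deg G v \<Longrightarrow> nbr G v i \<noteq> v"
    and inj_on_nbr: "v \<in> verts G \<Longrightarrow> inj_on (nbr G v) {..<deg G v}"
    and adj_nbr: "v \<in> verts G \<Longrightarrow> i < deg G v \<Longrightarrow> adj G (nbr G v i) v"
begin

lemma
  assumes "v \<in> verts G" "i < deg G v"
  shows backport_less_deg: "backport G v i < deg G (nbr G v i)"
    and nbr_backport: "nbr G (nbr G v i) (backport G v i) = v"
proof -
  have "\<exists>j. j < deg G (nbr G v i) \<and> nbr G (nbr G v i) j = v"
    using adj_nbr[OF assms] by (auto simp: adj_def)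
  from someI_ex[OF this] show "backport G v i < deg G (nbr G v i)"
    "nbr G (nbr G v i) (backport G v i) = v"
    by (auto simp: backport_def)
qed

lemma nbr_eq_nbr_iff:
  "v \<in> verts G \<Longrightarrow> i < deg G v \<Longrightarrow> j < deg G v \<Longrightarrow> nbr G v i = nbr G v j \<longleftrightarrow> i = j"
  using inj_on_eq_iff[OF inj_on_nbr] by simp

lemma backport_backport:
  assumes "v \<in> verts G" "i < deg G v"
  shows "backport G (nbr G v i) (backport G v i) = i"
  using backport_less_deg[OF nbr_in_verts[OF assms] backport_less_deg[OF assms]]
    nbr_backport[OF nbr_in_verts[OF assms] backport_less_deg[OF assms]] nbr_backport[OF assms]
    nbr_eq_nbr_iff[OF assms(1) _ assms(2)] by simp

lemma adj_sym: "x \<in> verts G \<Longrightarrow> adj G x y \<Longrightarrow> adj G y x"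
  using adj_nbr by (auto simp: adj_def)

lemma pview_verts_subset_verts:
  assumes "v \<in> verts G" shows "pview_verts k G v ex \<subseteq> verts G"
  using assms
proof (induction k arbitrary: v ex)
  case (Suc k)
  show ?case
    unfolding pview_verts_Suc using Suc.prems
    by (intro insert_subsetI UN_least Suc.IH nbr_in_verts) simp_all
qed simp

lemma epview_verts_subset_verts:
  "v \<in> verts G \<Longrightarrow> i < deg G v \<Longrightarrow> epview_verts k G v i \<subseteq> verts G"
  unfolding epview_verts_def using pview_verts_subset_verts nbr_in_verts by (meson Un_least)

lemma epview_verts_swap:
  "v \<in> verts G \<Longrightarrow> i < deg G v \<Longrightarrow>
    epview_verts k G (nbr G v i) (backport G v i) = epview_verts k G v i"
  by (auto simp: epview_verts_def nbr_backport backport_backport)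

definition nonbacktracking :: "'v list \<Rightarrow> bool" where
  "nonbacktracking p \<longleftrightarrow> set p \<subseteq> verts G \<and> successively (adj G) p \<and>
     (\<nexists>xs y z zs. p = xs @ [y, z, y] @ zs)"

lemma nonbacktracking_Cons:
  assumes "nonbacktracking (y # z # r)" "x \<in> verts G" "adj G x y" "x \<noteq> z"
  shows "nonbacktracking (x # y # z # r)"
  using assms unfolding nonbacktracking_def
  by (auto simp: successively_Cons Cons_eq_append_conv)

lemma nonbacktracking_appendD:
  assumes "nonbacktracking (p @ q)"
  shows "nonbacktracking p" "nonbacktracking q"
proof -
  have "\<nexists>xs y z zs. p = xs @ [y, z, y] @ zs" "\<nexists>xs y z zs. q = xs @ [y, z, y] @ zs"
    using assms unfolding nonbacktracking_def by (metis append.assoc)+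
  then show "nonbacktracking p" "nonbacktracking q"
    using assms by (auto simp: nonbacktracking_def successively_append_iff)
qed

lemma nonbacktracking_rev:
  assumes "nonbacktracking p" shows "nonbacktracking (rev p)"
proof -
  have "successively (\<lambda>x y. adj G y x) p"
    using assms adj_sym unfolding nonbacktracking_def
    by (auto intro: successively_mono[of "adj G"])
  moreover have "p = rev zs @ [y, z, y] @ rev xs" if "rev p = xs @ [y, z, y] @ zs" for xs y z zs
    using arg_cong[OF that, of rev] by simp
  ultimately show ?thesis
    using assms by (auto simp: nonbacktracking_def)
qed

lemma is_cycle_of_closed_nonbacktracking:
  assumes p: "nonbacktracking (p @ [x])" and closed: "hd p = x" "p \<noteq> []" and "distinct p"
  shows "is_cycle G p"
proof -
  obtain q where q: "p = x # q"
    using closed by (cases p) auto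
  have adj: "adj G ((p @ [x]) ! k) ((p @ [x]) ! Suc k)" if "k < length p" for k
    using p that by (auto simp: nonbacktracking_def successively_conv_nth)
  have "q \<noteq> []"
    using adj[of 0] nbr_neq p by (auto simp: q adj_def nonbacktracking_def)
  moreover have "q \<noteq> [y]" for y
  proof
    assume "q = [y]"
    then have "p @ [x] = [] @ [x, y, x] @ []"
      by (simp add: q)
    then show False
      using p unfolding nonbacktracking_def by blast
  qed
  ultimately have "length p \<ge> 3"
    by (cases q; cases "tl q") (auto simp: q)
  moreover have "adj G (p ! k) (p ! ((k + 1) mod length p))" if "k < length p" for k
  proof -
    have "p ! ((k + 1) mod length p) = (p @ [x]) ! Suc k"
      using that by (cases "Suc k = length p") (auto simp: nth_append q)
    then show ?thesis
      using adj[OF that] that by (simp add: nth_append)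
  qed
  ultimately show ?thesis
    using p \<open>distinct p\<close> by (auto simp: is_cycle_def nonbacktracking_def)
qed

lemma distinct_of_nonbacktracking:
  assumes girth: "girth_ge G m" and "nonbacktracking p" "length p \<le> m"
  shows "distinct p"
  using assms(2,3)
proof (induction p rule: measure_induct_rule[of length])
  case (less p)
  show ?case
  proof (cases "length p \<le> 1")
    case True
    then show ?thesis
      by (cases p) auto
  next
    case False
    then obtain x q y where p: "p = x # q @ [y]"
      by (metis append_butlast_last_id length_0_conv length_Cons le_numeral_extra(4) le_zero_eq
          list.exhaust zero_le_one One_nat_def)
    have "nonbacktracking (x # q)" "nonbacktracking (q @ [y])"
      using less.prems(1) nonbacktracking_appendD[of "x # q" "[y]"]
        nonbacktracking_appendD[of "[x]" "q @ [y]"]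
      by (simp_all add: p)
    then have "distinct (x # q)" "distinct (q @ [y])"
      using less.IH[of "x # q"] less.IH[of "q @ [y]"] less.prems(2) by (simp_all add: p)
    moreover have "x \<noteq> y"
    proof
      assume "x = y"
      then have "is_cycle G (x # q)"
        using less.prems(1) \<open>distinct (x # q)\<close>
        by (intro is_cycle_of_closed_nonbacktracking) (auto simp: p)
      then show False
        using girth less.prems(2) by (auto simp: girth_ge_def p)
    qed
    ultimately show ?thesis
      by (simp add: p)
  qed
qed

lemma nonbacktracking_to_pview_verts:
  assumes "x \<in> pview_verts k G v (Some i)" "v \<in> verts G" "i < deg G v"
    and "nonbacktracking (v # nbr G v i # r)"
  shows "\<exists>p. length p \<le> k \<and> nonbacktracking (p @ v # nbr G v i # r) \<and> hd (p @ [v]) = x"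
  using assms
proof (induction k arbitrary: v i r)
  case 0
  then show ?case by (intro exI[of _ "[]"]) simp
next
  case (Suc k)
  show ?case
  proof (cases "x = v")
    case True
    then show ?thesis using Suc.prems by (intro exI[of _ "[]"]) simp
  next
    case False
    then obtain l where l: "l < deg G v" "l \<noteq> i"
        "x \<in> pview_verts k G (nbr G v l) (Some (backport G v l))"
      using Suc.prems(1) by (auto simp: pview_verts_Suc)
    let ?u = "nbr G v l"
    have u: "?u \<in> verts G" "backport G v l < deg G ?u" "nbr G ?u (backport G v l) = v"
      using nbr_in_verts backport_less_deg nbr_backport Suc.prems(2) l(1) by auto
    have "nonbacktracking (?u # v # nbr G v i # r)"
      using nonbacktracking_Cons[OF Suc.prems(4) u(1)] adj_nbr nbr_eq_nbr_iff Suc.prems(2,3) l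
      by blast
    then obtain p where "length p \<le> k" "nonbacktracking (p @ ?u # v # nbr G v i # r)"
        "hd (p @ [?u]) = x"
      using Suc.IH[OF l(3) u(1,2), of "nbr G v i # r"] u(3) by auto
    then show ?thesis
      by (intro exI[of _ "p @ [?u]"]) (auto simp: hd_append)
  qed
qed

lemma pview_verts_disjoint_across_edge:
  assumes girth: "girth_ge G m" and v: "v \<in> verts G" "i < deg G v" and "a + b + 2 \<le> m"
  shows "pview_verts a G v (Some i) \<inter> pview_verts b G (nbr G v i) (Some (backport G v i)) = {}"
proof (rule ccontr)
  let ?u = "nbr G v i" and ?j = "backport G v i"
  assume "\<not> ?thesis"
  then obtain x where x: "x \<in> pview_verts a G v (Some i)" "x \<in> pview_verts b G ?u (Some ?j)"
    by blast
  have u: "?u \<in> verts G" "?j < deg G ?u" "nbr G ?u ?j = v"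
    using nbr_in_verts backport_less_deg nbr_backport v by auto
  have "nonbacktracking [?u, v]"
    using u v adj_nbr by (auto simp: nonbacktracking_def Cons_eq_append_conv)
  then obtain p where p: "length p \<le> b" "nonbacktracking (p @ [?u, v])" "hd (p @ [?u]) = x"
    using nonbacktracking_to_pview_verts[OF x(2) u(1,2), of "[]"] u(3) by auto
  have "nonbacktracking (v # ?u # rev p)"
    using nonbacktracking_rev[OF p(2)] by simp
  then obtain q where q: "length q \<le> a" "nonbacktracking (q @ v # ?u # rev p)" "hd (q @ [v]) = x"
    using nonbacktracking_to_pview_verts[OF x(1) v] by auto
  have "distinct ((q @ [v]) @ ?u # rev p)"
    using distinct_of_nonbacktracking[OF girth q(2)] p(1) q(1) \<open>a + b + 2 \<le> m\<close> by simp
  moreover have "x \<in> set (q @ [v])" "x \<in> set (p @ [?u])"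
    using p(3) q(3) by (metis hd_in_set snoc_eq_iff_butlast)+
  ultimately show False
    by auto
qed

lemma pview_verts_disjoint_children:
  assumes girth: "girth_ge G m" and v: "v \<in> verts G" "i < deg G v" "l < deg G v" "i \<noteq> l"
    and "2 * k + 3 \<le> m"
  shows "pview_verts k G (nbr G v i) (Some (backport G v i)) \<inter>
    pview_verts k G (nbr G v l) (Some (backport G v l)) = {}"
proof -
  have "pview_verts k G (nbr G v l) (Some (backport G v l)) \<subseteq> pview_verts (Suc k) G v (Some i)"
    using v by (auto simp: pview_verts_Suc)
  then show ?thesis
    using pview_verts_disjoint_across_edge[OF girth v(1,2), of "Suc k" k] \<open>2 * k + 3 \<le> m\<close> by auto
qed

lemma distinct_labels_pview_ident:
  assumes girth: "girth_ge G m" and "v \<in> verts G" "2 * k + 1 \<le> m"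
  shows "distinct (labels (pview k G (\<lambda>x. x) v ex))"
  using assms(2,3)
proof (induction k arbitrary: v ex)
  case (Suc k)
  define child where "child i = (if ex = Some i then []
    else labels (pview k G (\<lambda>x. x) (nbr G v i) (Some (backport G v i))))" for i
  have child_subset: "set (child i) \<subseteq> pview_verts k G (nbr G v i) (Some (backport G v i))" for i
    by (simp add: child_def set_labels pview_verts_def)
  have labels_eq: "labels (pview (Suc k) G (\<lambda>x. x) v ex) = v # concat (map child [0..<deg G v])"
    by (auto simp: pview.simps child_def intro!: arg_cong[of _ _ concat])
  have distinct_child: "distinct (child i)" if "i < deg G v" for i
    using Suc.IH nbr_in_verts[OF Suc.prems(1) that] Suc.prems(2) by (simp add: child_def)
  have child_disjoint: "set (child i) \<inter> set (child l) = {}"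
    if "i < deg G v" "l < deg G v" "i \<noteq> l" for i l
    using Int_mono[OF child_subset[of i] child_subset[of l]] Suc.prems(2)
      pview_verts_disjoint_children[OF girth Suc.prems(1) that, of k] by auto
  have "distinct (concat (map child [0..<n]))" if "n \<le> deg G v" for n
    using that
  proof (induction n)
    case (Suc n)
    then have "set (child n) \<inter> set (child l) = {}" if "l < n" for l
      using child_disjoint that by simp
    then show ?case
      using Suc distinct_child by (auto simp: disjoint_iff)
  qed simp
  moreover have "v \<notin> set (child i)" if "i < deg G v" for i
    using pview_verts_disjoint_across_edge[OF girth Suc.prems(1) that, of 0 k]
      child_subset[of i] Suc.prems(2) by auto
  ultimately show ?case
    by (auto simp: labels_eq)
qed simp

lemma distinct_labels_pview:
  assumes "girth_ge G m" "v \<in> verts G" "2 * k + 1 \<le> m" "inj_on a (verts G)"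
  shows "distinct (labels (pview k G a v ex))"
  unfolding pview_eq_map_view_pview_ident[of k G a] distinct_labels_map_view_iff
  using distinct_labels_pview_ident[OF assms(1-3)] pview_verts_subset_verts[OF assms(2)] assms(4)
  by (simp add: pview_verts_def inj_on_subset)

lemma distinct_labels_epview:
  assumes girth: "girth_ge G m" and v: "v \<in> verts G" "i < deg G v" and "2 * k + 2 \<le> m"
    and inj: "inj_on a (verts G)"
  shows "distinct (labels (epview k G a v i))"
proof -
  have "a ` pview_verts k G v (Some i) \<inter>
      a ` pview_verts k G (nbr G v i) (Some (backport G v i)) = {}"
    using inj_on_image_Int[OF inj pview_verts_subset_verts pview_verts_subset_verts,
        of v "nbr G v i"]
      pview_verts_disjoint_across_edge[OF girth v, of k k] nbr_in_verts v \<open>2 * k + 2 \<le> m\<close>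
    by (metis image_empty mult_2)
  then show ?thesis
    using distinct_labels_pview[OF girth _ _ inj] nbr_in_verts v \<open>2 * k + 2 \<le> m\<close>
    by (simp add: epview_def set_labels set1_view_pview)
qed

lemma pview_verts_inter_nbr:
  assumes girth: "girth_ge G m" and v: "v \<in> verts G" "i < deg G v" and "2 * k + 4 \<le> m"
  shows "pview_verts (Suc k) G v None \<inter> pview_verts (Suc k) G (nbr G v i) None =
    epview_verts k G v i"
proof -
  let ?u = "nbr G v i" and ?j = "backport G v i"
  have "pview_verts (Suc k) G v (Some i) \<inter> pview_verts (Suc k) G ?u (Some ?j) = {}"
    using pview_verts_disjoint_across_edge[OF girth v, of "Suc k" "Suc k"] \<open>2 * k + 4 \<le> m\<close> by simp
  moreover have "pview_verts (Suc k) G ?u None =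
      pview_verts (Suc k) G ?u (Some ?j) \<union> pview_verts k G v (Some i)"
    using pview_verts_Suc_None[of ?j G ?u k]
    by (simp add: backport_less_deg nbr_backport backport_backport v)
  ultimately show ?thesis
    using pview_verts_subset_Suc[of k G v "Some i"] pview_verts_subset_Suc[of k G ?u "Some ?j"]
    unfolding epview_verts_def pview_verts_Suc_None[OF v(2)] by auto
qed

lemma epview_verts_inter:
  assumes "girth_ge G m" "v \<in> verts G" "i < deg G v" "l < deg G v" "i \<noteq> l" "2 * k + 3 \<le> m"
  shows "epview_verts k G v i \<inter> epview_verts k G v l = pview_verts k G v None"
  using pview_verts_disjoint_children[OF assms]
    pview_verts_subset_epview_verts[of k G v i] pview_verts_subset_epview_verts[of k G v l]
    pview_verts_subset_None[of k G v "Some i"] pview_verts_subset_None[of k G v "Some l"]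
  unfolding epview_verts_def by auto

end

lemma epview_eq_swap:
  assumes "port_graph G" "port_graph G'"
    and "v \<in> verts G" "i < deg G v" "v' \<in> verts G'" "i < deg G' v'"
    and "epview k G a v i = epview k G' a' v' i"
  shows "epview k G a (nbr G v i) (backport G v i) =
    epview k G' a' (nbr G' v' i) (backport G' v' i)"
  using assms(7) port_graph.nbr_backport[OF assms(1,3,4)] port_graph.nbr_backport[OF assms(2,5,6)]
    port_graph.backport_backport[OF assms(1,3,4)] port_graph.backport_backport[OF assms(2,5,6)]
  by (auto simp: epview_def)

lemma epview_eq_of_pview_nbr_eq:
  assumes graphs: "port_graph G" "port_graph G'"
    and ports: "v \<in> verts G" "i < deg G v" "v' \<in> verts G'" "i < deg G' v'"
    and port_eq: "backport G v i = backport G' v' i"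
    and "pview (Suc k) G a (nbr G v i) None = pview (Suc k) G' a' (nbr G' v' i) None"
  shows "epview k G a v i = epview k G' a' v' i"
proof -
  interpret G: port_graph G by (rule graphs)
  interpret G': port_graph G' by (rule graphs)
  have "epview k G a (nbr G v i) (backport G v i) = epview k G' a' (nbr G' v' i) (backport G v i)"
    using assms(8) G.backport_less_deg[OF ports(1,2)] by (rule epview_eq_of_pview_eq)
  from epview_eq_swap[OF graphs G.nbr_in_verts[OF ports(1,2)] G.backport_less_deg[OF ports(1,2)]
      G'.nbr_in_verts[OF ports(3,4)] _ this]
  show ?thesis
    using G.nbr_backport[OF ports(1,2)] G.backport_backport[OF ports(1,2)] G'.backport_less_deg
      G'.nbr_backport[OF ports(3,4)] G'.backport_backport[OF ports(3,4)] ports(3,4)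
    by (simp add: port_eq)
qed

lemma order_equiv_epview_swap:
  assumes graphs: "port_graph G" "port_graph G'"
    and ports: "v \<in> verts G" "i < deg G v" "v' \<in> verts G'" "i < deg G' v'"
    and "order_equiv (epview k G a v i) (epview k G' a' v' i)"
  shows "order_equiv (epview k G a (nbr G v i) (backport G v i))
    (epview k G' a' (nbr G' v' i) (backport G' v' i))"
  using assms(7)
proof (rule order_equiv_transfer)
  show "set1_view (epview k G a (nbr G v i) (backport G v i)) \<subseteq> set1_view (epview k G a v i)"
    by (simp add: set1_view_epview port_graph.epview_verts_swap graphs ports)
qed (use epview_eq_swap[OF graphs ports] in \<open>simp add: map_view_epview\<close>)

section \<open>Constraints of the derived problems\<close>

lemma pair_mset_eq_iff: "{#a, b#} = {#c, d#} \<longleftrightarrow> a = c \<and> b = d \<or> a = d \<and> b = c"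
  by (auto simp: add_eq_conv_ex)

lemma rel_mset_image_mset_set_iff:
  assumes "finite A"
  shows "rel_mset R (image_mset f (mset_set A)) N \<longleftrightarrow>
    (\<exists>g. N = image_mset g (mset_set A) \<and> (\<forall>x\<in>A. R (f x) (g x)))"
proof
  assume "rel_mset R (image_mset f (mset_set A)) N"
  with assms show "\<exists>g. N = image_mset g (mset_set A) \<and> (\<forall>x\<in>A. R (f x) (g x))"
  proof (induction A arbitrary: N rule: finite_induct)
    case (insert x A)
    obtain c N' where N: "N = add_mset c N'" "R (f x) c"
      and "rel_mset R (image_mset f (mset_set A)) N'"
      using msed_rel_invL[of R "f x" "image_mset f (mset_set A)" N] insert.prems insert.hyps by auto
    then obtain g where g: "N' = image_mset g (mset_set A)" "\<forall>x\<in>A. R (f x) (g x)"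
      using insert.IH by blast
    have "image_mset (g(x := c)) (mset_set A) = image_mset g (mset_set A)"
      using insert.hyps by (intro image_mset_cong) auto
    then have "N = image_mset (g(x := c)) (mset_set (insert x A))"
      using insert.hyps N(1) g(1) by (simp add: fun_upd_same del: fun_upd_apply)
    moreover have "\<forall>y\<in>insert x A. R (f y) ((g(x := c)) y)"
      using N(2) g(2) insert.hyps by auto
    ultimately show ?case
      by blast
  qed simp
next
  assume "\<exists>g. N = image_mset g (mset_set A) \<and> (\<forall>x\<in>A. R (f x) (g x))"
  then show "rel_mset R (image_mset f (mset_set A)) N"
    using assms by (auto simp: multiset.rel_map intro!: multiset.rel_refl_strong)
qed

lemma outs_half [simp]: "outs (half P) D = Pow (outs P D)"
  and outs_half' [simp]: "outs (half' P) D = Pow (outs P D)"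
  and nodec_half' [simp]: "nodec (half' P) D = nodec (half P) D"
  by (simp_all add: half_def half'_def)

lemma outs_one_from [simp]: "outs (one_from Q) D = Pow (outs Q D)"
  by (simp add: one_from_def)

lemma allcomp_sym: "allcomp P D Y Z \<longleftrightarrow> allcomp P D Z Y"
  unfolding allcomp_def by (metis add_mset_commute)

lemma edgec_half_iff:
  "{#Y, Z#} \<in> edgec (half P) D \<longleftrightarrow> Y \<subseteq> outs P D \<and> Z \<subseteq> outs P D \<and> allcomp P D Y Z"
  using allcomp_sym[of P D Y Z] by (auto simp: half_def pair_mset_eq_iff)

lemma edgec_one_from_iff:
  "{#Y, Z#} \<in> edgec (one_from Q) D \<longleftrightarrow> Y \<subseteq> outs Q D \<and> Z \<subseteq> outs Q D \<and>
     (\<exists>y\<in>Y. \<exists>z\<in>Z. {#y, z#} \<in> edgec Q D)"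
  by (auto simp: one_from_def pair_mset_eq_iff) (metis add_mset_commute)

lemma nodec_half_iff:
  "finite A \<Longrightarrow> image_mset Y (mset_set A) \<in> nodec (half P) D \<longleftrightarrow>
     card A \<le> D \<and> (\<forall>i\<in>A. Y i \<subseteq> outs P D) \<and>
     (\<exists>y. (\<forall>i\<in>A. y i \<in> Y i) \<and> image_mset y (mset_set A) \<in> nodec P D)"
  by (auto simp: half_def rel_mset_image_mset_set_iff)

lemma allnode_iff:
  "finite A \<Longrightarrow> allnode Q D (image_mset Y (mset_set A)) \<longleftrightarrow>
     (\<forall>y. (\<forall>i\<in>A. y i \<in> Y i) \<longrightarrow> image_mset y (mset_set A) \<in> nodec Q D)"
  by (auto simp: allnode_def rel_mset_image_mset_set_iff)

lemma nodec_one_from_iff: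
  "finite A \<Longrightarrow> image_mset Y (mset_set A) \<in> nodec (one_from Q) D \<longleftrightarrow>
     card A \<le> D \<and> (\<forall>i\<in>A. Y i \<subseteq> outs Q D) \<and> allnode Q D (image_mset Y (mset_set A))"
  by (auto simp: one_from_def)

definition compatible_pair :: "'o lcl_problem \<Rightarrow> nat \<Rightarrow> 'o set \<Rightarrow> 'o set \<Rightarrow> 'o \<times> 'o" where
  "compatible_pair Q D Y Z = (SOME p. fst p \<in> Y \<and> snd p \<in> Z \<and> {#fst p, snd p#} \<in> edgec Q D)"

lemma compatible_pair_compatible:
  assumes "{#Y, Z#} \<in> edgec (one_from Q) D"
  shows "fst (compatible_pair Q D Y Z) \<in> Y" "snd (compatible_pair Q D Y Z) \<in> Z"
    "{#fst (compatible_pair Q D Y Z), snd (compatible_pair Q D Y Z)#} \<in> edgec Q D"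
proof -
  have "\<exists>p. fst p \<in> Y \<and> snd p \<in> Z \<and> {#fst p, snd p#} \<in> edgec Q D"
    using assms by (auto simp: edgec_one_from_iff)
  from someI_ex[OF this] show "fst (compatible_pair Q D Y Z) \<in> Y"
    "snd (compatible_pair Q D Y Z) \<in> Z"
    "{#fst (compatible_pair Q D Y Z), snd (compatible_pair Q D Y Z)#} \<in> edgec Q D"
    by (simp_all add: compatible_pair_def)
qed

subsection \<open>Maximality on edges\<close>

definition edge_polar :: "'o lcl_problem \<Rightarrow> nat \<Rightarrow> 'o set \<Rightarrow> 'o set" where
  "edge_polar P D Z = {y \<in> outs P D. allcomp P D {y} Z}"

lemma subset_edge_polar_iff: "Y \<subseteq> edge_polar P D Z \<longleftrightarrow> Y \<subseteq> outs P D \<and> allcomp P D Y Z"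
  by (auto simp: edge_polar_def allcomp_def)

lemma edge_polar_subset: "edge_polar P D Z \<subseteq> outs P D"
  by (auto simp: edge_polar_def)

lemma allcomp_edge_polar: "allcomp P D (edge_polar P D Z) Z"
  by (auto simp: edge_polar_def allcomp_def)

lemma edge_polar_antimono: "Z \<subseteq> Z' \<Longrightarrow> edge_polar P D Z' \<subseteq> edge_polar P D Z"
  by (auto simp: edge_polar_def allcomp_def)

lemma subset_edge_polar_polar:
  "Z \<subseteq> outs P D \<Longrightarrow> Z \<subseteq> edge_polar P D (edge_polar P D Z)"
  using subset_edge_polar_iff[of "edge_polar P D Z" P D Z]
  by (simp add: subset_edge_polar_iff allcomp_sym[of P D Z])

lemma edgec_half'_iff:
  "{#Y, Z#} \<in> edgec (half' P) D \<longleftrightarrow> Y = edge_polar P D Z \<and> Z = edge_polar P D Y"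
proof -
  define maximal where "maximal Y Z \<longleftrightarrow> Y \<subseteq> outs P D \<and> Z \<subseteq> outs P D \<and> allcomp P D Y Z \<and>
      (\<forall>Y'. Y \<subset> Y' \<and> Y' \<subseteq> outs P D \<longrightarrow> \<not> allcomp P D Y' Z) \<and>
      (\<forall>Z'. Z \<subset> Z' \<and> Z' \<subseteq> outs P D \<longrightarrow> \<not> allcomp P D Y Z')" for Y Z
  have "maximal Y Z \<longleftrightarrow> Y = edge_polar P D Z \<and> Z = edge_polar P D Y" for Y Z
  proof
    assume max: "maximal Y Z"
    then have "Y \<subseteq> edge_polar P D Z" "Z \<subseteq> edge_polar P D Y"
      using allcomp_sym[of P D Y Z] by (simp_all add: maximal_def subset_edge_polar_iff)
    moreover have "\<not> Y \<subset> edge_polar P D Z"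
      using max allcomp_edge_polar edge_polar_subset unfolding maximal_def by metis
    moreover have "\<not> Z \<subset> edge_polar P D Y"
      using max allcomp_sym[THEN iffD1, OF allcomp_edge_polar] edge_polar_subset
      unfolding maximal_def by metis
    ultimately show "Y = edge_polar P D Z \<and> Z = edge_polar P D Y"
      by blast
  next
    assume polar: "Y = edge_polar P D Z \<and> Z = edge_polar P D Y"
    then have "Y' \<subseteq> Y" if "allcomp P D Y' Z" "Y' \<subseteq> outs P D" for Y'
      using subset_edge_polar_iff that by metis
    moreover have "Z' \<subseteq> Z" if "allcomp P D Y Z'" "Z' \<subseteq> outs P D" for Z'
      using polar subset_edge_polar_iff allcomp_sym that by metis
    moreover have "Y \<subseteq> outs P D" "Z \<subseteq> outs P D" "allcomp P D Y Z"
      using polar subset_edge_polar_iff order_refl by metis+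
    ultimately show "maximal Y Z"
      unfolding maximal_def by blast
  qed
  moreover have "{#Y, Z#} \<in> edgec (half' P) D \<longleftrightarrow> maximal Y Z \<or> maximal Z Y"
    by (auto simp: half'_def maximal_def pair_mset_eq_iff)
  ultimately show ?thesis
    by auto
qed

lemma edgec_half'_subset: "edgec (half' P) D \<subseteq> edgec (half P) D"
  by (auto simp: half_def half'_def)

lemma edgec_half_extend_maximal:
  assumes "{#y, z#} \<in> edgec (half P) D"
  obtains y' z' where "y \<subseteq> y'" "z \<subseteq> z'" "{#y', z'#} \<in> edgec (half' P) D"
proof
  let ?p = "edge_polar P D"
  have z: "z \<subseteq> outs P D" "allcomp P D y z" "y \<subseteq> outs P D"
    using assms by (auto simp: edgec_half_iff)
  show "y \<subseteq> ?p z"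
    using z by (simp add: subset_edge_polar_iff)
  show "z \<subseteq> ?p (?p z)"
    using z(1) by (rule subset_edge_polar_polar)
  have "?p z = ?p (?p (?p z))"
    using edge_polar_antimono[OF subset_edge_polar_polar[OF z(1)]]
      subset_edge_polar_polar[of "?p z"]
    by (simp add: subset_antisym edge_polar_subset)
  then show "{#?p z, ?p (?p z)#} \<in> edgec (half' P) D"
    by (simp add: edgec_half'_iff)
qed

lemma edgec_one'_of_edgec_one:
  assumes "{#Y, Y'#} \<in> edgec (one P) D"
    and "Y \<subseteq> Z" "Z \<subseteq> Pow (outs P D)" "\<And>y z. y \<in> Z \<Longrightarrow> y \<subseteq> z \<Longrightarrow> z \<subseteq> outs P D \<Longrightarrow> z \<in> Z"
    and "Y' \<subseteq> Z'" "Z' \<subseteq> Pow (outs P D)" "\<And>y z. y \<in> Z' \<Longrightarrow> y \<subseteq> z \<Longrightarrow> z \<subseteq> outs P D \<Longrightarrow> z \<in> Z'"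
  shows "{#Z, Z'#} \<in> edgec (one' P) D"
proof -
  obtain y y' where y: "y \<in> Y" "y' \<in> Y'" "{#y, y'#} \<in> edgec (half P) D"
    using assms(1) by (auto simp: one_def edgec_one_from_iff)
  obtain z z' where "y \<subseteq> z" "y' \<subseteq> z'" and maximal: "{#z, z'#} \<in> edgec (half' P) D"
    using edgec_half_extend_maximal[OF y(3)] by blast
  moreover have "z \<subseteq> outs P D" "z' \<subseteq> outs P D"
    using subsetD[OF edgec_half'_subset maximal] by (simp_all add: edgec_half_iff)
  ultimately have "z \<in> Z" "z' \<in> Z'"
    using y assms(2,4,5,7) by blast+
  with maximal show ?thesis
    using assms(3,6) by (auto simp: one'_def edgec_one_from_iff)
qed

subsection \<open>Maximality at nodes\<close>

definition maximal_allnode :: "'o lcl_problem \<Rightarrow> nat \<Rightarrow> 'o set multiset \<Rightarrow> bool" where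
  "maximal_allnode Q D M \<longleftrightarrow> allnode Q D M \<and>
     (\<forall>Y\<in>#M. \<forall>Y'. Y \<subset> Y' \<and> Y' \<subseteq> outs Q D \<longrightarrow> \<not> allnode Q D (add_mset Y' (M - {#Y#})))"

lemma nodec_one'_iff:
  "M \<in> nodec (one' P) D \<longleftrightarrow> M \<in> nodec (one P) D \<and> maximal_allnode (half P) D M"
  by (auto simp: one'_def one_def one_from_def maximal_allnode_def allnode_def)

lemma maximal_allnode_completion:
  assumes fin: "finite (outs Q D)" "finite A"
    and Y: "\<And>i. i \<in> A \<Longrightarrow> Y i \<subseteq> outs Q D" "allnode Q D (image_mset Y (mset_set A))"
  obtains Z where "\<And>i. i \<in> A \<Longrightarrow> Y i \<subseteq> Z i" "\<And>i. i \<in> A \<Longrightarrow> Z i \<subseteq> outs Q D"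
    "maximal_allnode Q D (image_mset Z (mset_set A))"
proof -
  define admissible where "admissible Z \<longleftrightarrow>
    (\<forall>i\<in>A. Y i \<subseteq> Z i \<and> Z i \<subseteq> outs Q D) \<and> allnode Q D (image_mset Z (mset_set A))" for Z
  define weight where "weight Z = (\<Sum>i\<in>A. card (Z i))" for Z :: "'b \<Rightarrow> 'a set"
  have "weight Z < Suc (card A * card (outs Q D))" if "admissible Z" for Z
    using that fin(1) sum_bounded_above[of A "\<lambda>i. card (Z i)" "card (outs Q D)"]
    by (auto simp: weight_def admissible_def card_mono)
  moreover have "admissible Y"
    using Y by (simp add: admissible_def)
  ultimately obtain Z where Z: "admissible Z" and heaviest: "\<And>X. admissible X \<Longrightarrow> weight X \<le> weight Z"
    using ex_has_greatest_nat[of admissible Y weight] by blast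
  have "\<not> allnode Q D (add_mset W (image_mset Z (mset_set A) - {#Z l#}))"
    if l: "l \<in> A" "Z l \<subset> W" "W \<subseteq> outs Q D" for l W
  proof
    assume allnode: "allnode Q D (add_mset W (image_mset Z (mset_set A) - {#Z l#}))"
    have "image_mset (Z(l := W)) (mset_set (A - {l})) = image_mset Z (mset_set (A - {l}))"
      using fin(2) by (intro image_mset_cong) auto
    then have "admissible (Z(l := W))"
      using Z l allnode fin(2) by (auto simp: admissible_def mset_set.remove[of A l])
    moreover have "weight Z < weight (Z(l := W))"
      unfolding weight_def
    proof (rule sum_strict_mono_ex1[OF fin(2)])
      show "\<forall>i\<in>A. card (Z i) \<le> card ((Z(l := W)) i)" "\<exists>i\<in>A. card (Z i) < card ((Z(l := W)) i)"
        using l finite_subset[OF l(3) fin(1)] by (auto simp: card_mono psubset_card_mono)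
    qed
    ultimately show False
      using heaviest by fastforce
  qed
  then have "maximal_allnode Q D (image_mset Z (mset_set A))"
    using Z fin(2) by (auto simp: maximal_allnode_def admissible_def)
  then show thesis
    using that Z by (auto simp: admissible_def)
qed

lemma nodec_half_mono:
  assumes "add_mset y N \<in> nodec (half P) D" "y \<subseteq> y'" "y' \<subseteq> outs P D"
  shows "add_mset y' N \<in> nodec (half P) D"
proof -
  obtain K where K: "K \<in> nodec P D" "rel_mset (\<lambda>Y y. y \<in> Y) (add_mset y N) K"
    using assms(1) by (auto simp: half_def)
  obtain c K' where "K = add_mset c K'" "c \<in> y" "rel_mset (\<lambda>Y y. y \<in> Y) N K'"
    using msed_rel_invL[OF K(2)] by blast
  then have "rel_mset (\<lambda>Y y. y \<in> Y) (add_mset y' N) K"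
    using assms(2) rel_mset_Plus[of "\<lambda>Y y. y \<in> Y" y' c N K'] by auto
  then show ?thesis
    using assms K(1) by (auto simp: half_def)
qed

lemma maximal_allnode_upward_closed:
  assumes max: "maximal_allnode (half P) D M" and Y: "Y \<in># M" "Y \<subseteq> Pow (outs P D)"
    and y: "y \<in> Y" "y \<subseteq> y'" "y' \<subseteq> outs P D"
  shows "y' \<in> Y"
proof (rule ccontr)
  assume "y' \<notin> Y"
  obtain M' where M: "M = add_mset Y M'"
    using Y(1) by (metis multi_member_split)
  have "N \<in> nodec (half P) D"
    if "rel_mset (\<lambda>Y y. y \<in> Y) (add_mset (insert y' Y) M') N" for N
  proof -
    from msed_rel_invL[OF that] obtain c N' where c: "N = add_mset c N'" "c \<in> insert y' Y"
      and N': "rel_mset (\<lambda>Y y. y \<in> Y) M' N'"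
      by blast
    have "add_mset x N' \<in> nodec (half P) D" if "x \<in> Y" for x
      using max rel_mset_Plus[of "\<lambda>Y y. y \<in> Y" Y x, OF that N']
      by (auto simp: M maximal_allnode_def allnode_def)
    then show ?thesis
      using c y nodec_half_mono by blast
  qed
  then have "allnode (half P) D (add_mset (insert y' Y) M')"
    by (simp add: allnode_def)
  moreover have "Y \<subset> insert y' Y" "insert y' Y \<subseteq> Pow (outs P D)"
    using \<open>y' \<notin> Y\<close> Y(2) y(3) by auto
  ultimately show False
    using max by (auto simp: M maximal_allnode_def)
qed

section \<open>Order-determined output assignments\<close>

definition valid_output :: "'o lcl_problem \<Rightarrow> nat \<Rightarrow> ('v, 'l) pgraph \<Rightarrow> ('v \<Rightarrow> nat \<Rightarrow> 'o) \<Rightarrow> bool" where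
  "valid_output P D G out \<longleftrightarrow>
     (\<forall>v\<in>verts G. \<forall>i<deg G v. out v i \<in> outs P D \<and>
        {#out v i, out (nbr G v i) (backport G v i)#} \<in> edgec P D) \<and>
     (\<forall>v\<in>verts G. image_mset (out v) (mset_set {..<deg G v}) \<in> nodec P D)"

lemma solves_on_iff_valid_output:
  "solves_on P D A t G a \<longleftrightarrow> valid_output P D G (\<lambda>v i. A (pview t G a v None) i)"
  by (auto simp: solves_on_def valid_output_def Let_def atLeast0LessThan)

lemma (in port_graph) valid_output_cong:
  assumes "\<And>v i. v \<in> verts G \<Longrightarrow> i < deg G v \<Longrightarrow> out v i = out' v i"
  shows "valid_output P D G out \<longleftrightarrow> valid_output P D G out'"
proof -
  have "image_mset (out v) (mset_set {..<deg G v}) = image_mset (out' v) (mset_set {..<deg G v})"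
    if "v \<in> verts G" for v
    using assms[OF that] by (intro image_mset_cong) auto
  moreover have "out (nbr G v i) (backport G v i) = out' (nbr G v i) (backport G v i)"
    if "v \<in> verts G" "i < deg G v" for v i
    using assms nbr_in_verts backport_less_deg that by blast
  ultimately show ?thesis
    using assms by (auto simp: valid_output_def)
qed

type_synonym ('v, 'l, 'x) port_assignment = "('v, 'l) pgraph \<Rightarrow> ('v \<Rightarrow> nat) \<Rightarrow> 'v \<Rightarrow> nat \<Rightarrow> 'x"

abbreviation node_view ::
  "nat \<Rightarrow> ('v, 'l) pgraph \<Rightarrow> ('v \<Rightarrow> 'a) \<Rightarrow> 'v \<Rightarrow> nat \<Rightarrow> ('a, 'l) view" where
  "node_view k \<equiv> \<lambda>G a v i. pview k G a v None"

locale id_graph_class =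
  fixes C :: "('v, 'l) pgraph set" and S :: "nat set"
  assumes port_graph: "G \<in> C \<Longrightarrow> port_graph G"
begin

definition id_graph :: "('v, 'l) pgraph \<Rightarrow> ('v \<Rightarrow> nat) \<Rightarrow> bool" where
  "id_graph G a \<longleftrightarrow> G \<in> C \<and> inj_on a (verts G) \<and> a ` verts G \<subseteq> S"

definition id_port :: "('v, 'l) pgraph \<Rightarrow> ('v \<Rightarrow> nat) \<Rightarrow> 'v \<Rightarrow> nat \<Rightarrow> bool" where
  "id_port G a v i \<longleftrightarrow> id_graph G a \<and> v \<in> verts G \<and> i < deg G v"

definition order_determined ::
    "('v, 'l, (nat, 'l) view) port_assignment \<Rightarrow> ('v, 'l, 'o) port_assignment \<Rightarrow> bool" where
  "order_determined view out \<longleftrightarrow> (\<forall>G a v G' a' v' i. id_port G a v i \<longrightarrow> id_port G' a' v' i \<longrightarrow>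
     order_equiv (view G a v i) (view G' a' v' i) \<longrightarrow> out G a v i = out G' a' v' i)"

definition solves :: "'o lcl_problem \<Rightarrow> nat \<Rightarrow> ('v, 'l, 'o) port_assignment \<Rightarrow> bool" where
  "solves P D out \<longleftrightarrow> (\<forall>G a. id_graph G a \<longrightarrow> valid_output P D G (out G a))"

text \<open>With \<open>view = node_view k\<close> this is solvability in \<open>k\<close> rounds; with \<open>view = epview k\<close> the output
  at a port may depend on all that the two endpoints of its edge know after \<open>k\<close> rounds, that is, on
  \<open>N\<^sup>k\<^sup>+\<^sup>1(e)\<close>.\<close>
definition solvable ::
    "('v, 'l, (nat, 'l) view) port_assignment \<Rightarrow> 'o lcl_problem \<Rightarrow> nat \<Rightarrow> bool" where
  "solvable view P D \<longleftrightarrow> (\<exists>out. order_determined view out \<and> solves P D out)"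

lemma id_portD:
  assumes "id_port G a v i"
  shows "id_graph G a" "port_graph G" "v \<in> verts G" "i < deg G v"
  using assms port_graph by (auto simp: id_port_def id_graph_def)

lemma id_port_swap:
  assumes "id_port G a v i"
  shows "id_port G a (nbr G v i) (backport G v i)"
  using id_portD(1)[OF assms] port_graph.nbr_in_verts[OF id_portD(2-4)[OF assms]]
    port_graph.backport_less_deg[OF id_portD(2-4)[OF assms]]
  by (simp add: id_port_def)

lemma id_port_swap_swap:
  assumes "id_port G a v i"
  shows "nbr G (nbr G v i) (backport G v i) = v" "backport G (nbr G v i) (backport G v i) = i"
  using port_graph.nbr_backport[OF id_portD(2-4)[OF assms]]
    port_graph.backport_backport[OF id_portD(2-4)[OF assms]] .

lemma
  assumes "solves P D out" "id_port G a v i"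
  shows solves_outs: "out G a v i \<in> outs P D"
    and solves_edgec: "{#out G a v i, out G a (nbr G v i) (backport G v i)#} \<in> edgec P D"
  using assms by (auto simp: solves_def id_port_def valid_output_def)

lemma solves_nodec:
  "solves P D out \<Longrightarrow> id_graph G a \<Longrightarrow> v \<in> verts G \<Longrightarrow>
    image_mset (out G a v) (mset_set {..<deg G v}) \<in> nodec P D"
  by (auto simp: solves_def valid_output_def)

lemma solvesI:
  assumes "\<And>G a v i. id_port G a v i \<Longrightarrow> out G a v i \<in> outs P D"
    and "\<And>G a v i. id_port G a v i \<Longrightarrow>
      {#out G a v i, out G a (nbr G v i) (backport G v i)#} \<in> edgec P D"
    and "\<And>G a v. id_graph G a \<Longrightarrow> v \<in> verts G \<Longrightarrow>
      image_mset (out G a v) (mset_set {..<deg G v}) \<in> nodec P D"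
  shows "solves P D out"
  using assms by (simp add: solves_def valid_output_def id_port_def)

lemma order_determinedD:
  "order_determined view out \<Longrightarrow> id_port G a v i \<Longrightarrow> id_port G' a' v' i \<Longrightarrow>
    order_equiv (view G a v i) (view G' a' v' i) \<Longrightarrow> out G a v i = out G' a' v' i"
  unfolding order_determined_def by blast

lemma order_determined_coarser_view:
  assumes "order_determined view out"
    and "\<And>G a v i G' a' v'. id_port G a v i \<Longrightarrow> id_port G' a' v' i \<Longrightarrow>
      order_equiv (view' G a v i) (view' G' a' v' i) \<Longrightarrow> order_equiv (view G a v i) (view G' a' v' i)"
  shows "order_determined view' out"
  unfolding order_determined_def
proof (intro allI impI)
  fix G a v G' a' v' i
  assume "id_port G a v i" "id_port G' a' v' i" "order_equiv (view' G a v i) (view' G' a' v' i)"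
  then show "out G a v i = out G' a' v' i"
    by (intro order_determinedD[OF assms(1)] assms(2))
qed

lemma order_equiv_epview_id_port_swap:
  assumes ports: "id_port G a v i" "id_port G' a' v' i"
    and equiv: "order_equiv (epview k G a v i) (epview k G' a' v' i)"
  shows "order_equiv (epview k G a (nbr G v i) (backport G v i))
    (epview k G' a' (nbr G' v' i) (backport G' v' i))"
  using id_portD[OF ports(1)] id_portD[OF ports(2)] equiv by (intro order_equiv_epview_swap)

lemma order_determined_algorithm:
  assumes det: "order_determined (node_view k) out"
  obtains A :: "(nat, 'l) view \<Rightarrow> nat \<Rightarrow> 'o" where "order_invariant A"
    "\<And>G a v i. id_port G a v i \<Longrightarrow> A (pview k G a v None) i = out G a v i"
proof
  define A where "A V i = (SOME y. \<exists>G a v. id_port G a v i \<and>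
    order_equiv V (pview k G a v None) \<and> y = out G a v i)" for V i
  show "order_invariant A"
    by (auto simp: order_invariant_iff_order_equiv A_def[abs_def] order_equiv_cong_left)
  show "A (pview k G a v None) i = out G a v i" if "id_port G a v i" for G a v i
    unfolding A_def
  proof (rule some_equality)
    show "\<exists>G' a' v'. id_port G' a' v' i \<and>
        order_equiv (pview k G a v None) (pview k G' a' v' None) \<and> out G a v i = out G' a' v' i"
      using that order_equiv_refl by blast
  qed (use order_determinedD[OF det that] in metis)
qed

lemma order_invariant_solvable_iff:
  "(\<exists>A :: (nat, 'l) view \<Rightarrow> nat \<Rightarrow> 'o. order_invariant A \<and> solves_with_ids P D A k C S) \<longleftrightarrow>
    solvable (node_view k) P D"
proof
  assume "\<exists>A :: (nat, 'l) view \<Rightarrow> nat \<Rightarrow> 'o. order_invariant A \<and> solves_with_ids P D A k C S"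
  then obtain A :: "(nat, 'l) view \<Rightarrow> nat \<Rightarrow> 'o"
    where "order_invariant A" "solves_with_ids P D A k C S"
    by blast
  then show "solvable (node_view k) P D"
    unfolding solvable_def solves_def order_determined_def solves_with_ids_def
      solves_on_iff_valid_output order_invariant_iff_order_equiv id_graph_def
    by (intro exI[of _ "\<lambda>G a v i. A (pview k G a v None) i"]) auto
next
  assume "solvable (node_view k) P D"
  then obtain out where det: "order_determined (node_view k) out" and out: "solves P D out"
    by (auto simp: solvable_def)
  obtain A where A: "order_invariant A"
    "\<And>G a v i. id_port G a v i \<Longrightarrow> A (pview k G a v None) i = out G a v i"
    using order_determined_algorithm[OF det] by blast
  have "valid_output P D G (\<lambda>v. A (pview k G a v None))" if "id_graph G a" for G a
    using out A(2) that port_graph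
      port_graph.valid_output_cong[of G "\<lambda>v. A (pview k G a v None)" "out G a"]
    by (auto simp: solves_def id_port_def id_graph_def)
  then have "solves_with_ids P D A k C S"
    by (simp add: solves_with_ids_def solves_on_iff_valid_output id_graph_def)
  with A(1) show "\<exists>A :: (nat, 'l) view \<Rightarrow> nat \<Rightarrow> 'o. order_invariant A \<and> solves_with_ids P D A k C S"
    by blast
qed

lemma order_determined_node_choice:
  fixes R :: "nat \<Rightarrow> (nat \<Rightarrow> 'x) \<Rightarrow> (nat \<Rightarrow> 'y) \<Rightarrow> bool"
  assumes det: "order_determined (node_view k) out"
    and cong: "\<And>d f g. (\<And>i. i < d \<Longrightarrow> f i = g i) \<Longrightarrow> R d f = R d g"
    and ex: "\<And>G a v. id_graph G a \<Longrightarrow> v \<in> verts G \<Longrightarrow> \<exists>x. R (deg G v) (out G a v) x"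
  obtains out' where "order_determined (node_view k) out'"
    "\<And>G a v. id_graph G a \<Longrightarrow> v \<in> verts G \<Longrightarrow> R (deg G v) (out G a v) (out' G a v)"
proof
  define out' where "out' G a v = (SOME x. R (deg G v) (out G a v) x)" for G a v
  show "R (deg G v) (out G a v) (out' G a v)" if "id_graph G a" "v \<in> verts G" for G a v
    unfolding out'_def using ex[OF that] by (rule someI_ex)
  have "out' G a v = out' G' a' v'"
    if "id_port G a v i" "id_port G' a' v' i"
      and equiv: "order_equiv (pview k G a v None) (pview k G' a' v' None)" for G a v G' a' v' i
  proof -
    have "deg G v = deg G' v'"
      using equiv by (rule deg_eq_of_order_equiv)
    moreover have "out G a v j = out G' a' v' j" if "j < deg G v" for j
      using order_determinedD[OF det _ _ equiv] \<open>id_port G a v i\<close> \<open>id_port G' a' v' i\<close>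
        \<open>deg G v = deg G' v'\<close> that by (simp add: id_port_def)
    ultimately show ?thesis
      unfolding out'_def using cong by metis
  qed
  then show "order_determined (node_view k) out'"
    unfolding order_determined_def by metis
qed

definition possible_outputs ::
    "('v, 'l, (nat, 'l) view) port_assignment \<Rightarrow> ('v, 'l, 'o) port_assignment \<Rightarrow>
     ('v, 'l, 'o set) port_assignment" where
  "possible_outputs view out G a v i =
     {out H b w i | H b w. id_port H b w i \<and> order_equiv (view G a v i) (view H b w i)}"

lemma order_determined_possible_outputs: "order_determined view (possible_outputs view out)"
  by (auto simp: order_determined_def possible_outputs_def order_equiv_cong_left)

lemma output_in_possible_outputs:
  "id_port G a v i \<Longrightarrow> out G a v i \<in> possible_outputs view out G a v i"
  unfolding possible_outputs_def
  by (intro CollectI exI[of _ G] exI[of _ a] exI[of _ v] conjI refl order_equiv_refl)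

lemma possible_outputs_subset:
  assumes "solves P D out"
  shows "possible_outputs view out G a v i \<subseteq> outs P D"
  using solves_outs[OF assms] by (auto simp: possible_outputs_def)

lemma possible_outputs_across_edge:
  assumes port: "id_port G a v i"
    and y: "y \<in> possible_outputs (epview k) out G a (nbr G v i) (backport G v i)"
  obtains H b w where "id_port H b w i" "y = out H b (nbr H w i) (backport H w i)"
    "order_equiv (epview k G a v i) (epview k H b w i)"
proof -
  let ?j = "backport G v i"
  obtain H b u where u: "id_port H b u ?j" "y = out H b u ?j"
      "order_equiv (epview k G a (nbr G v i) ?j) (epview k H b u ?j)"
    using y by (auto simp: possible_outputs_def)
  have port_eq: "backport H u ?j = i"
    using backport_eq_of_order_equiv[OF u(3)] by (simp add: id_port_swap_swap[OF port])
  show thesis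
  proof (rule that)
    show "id_port H b (nbr H u ?j) i"
      using id_port_swap[OF u(1)] by (simp add: port_eq)
    show "y = out H b (nbr H (nbr H u ?j) i) (backport H (nbr H u ?j) i)"
      using id_port_swap_swap[OF u(1)] u(2) by (simp add: port_eq)
    show "order_equiv (epview k G a v i) (epview k H b (nbr H u ?j) i)"
      using order_equiv_epview_id_port_swap[OF id_port_swap[OF port] u(1,3)]
      by (simp add: id_port_swap_swap[OF port] port_eq)
  qed
qed

section \<open>Reductions that need no independence\<close>

lemma solvable_of_solvable_half:
  assumes "solvable (epview k) (half P) D"
  shows "solvable (node_view (Suc k)) P D"
proof -
  obtain Y where "order_determined (epview k) Y" and Y: "solves (half P) D Y"
    using assms by (auto simp: solvable_def)
  from this(1) have det: "order_determined (node_view (Suc k)) Y"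
    by (rule order_determined_coarser_view)
      (auto simp: id_port_def intro: order_equiv_epview_of_pview)
  define selects where "selects d Y y \<longleftrightarrow>
    (\<forall>i\<in>{..<d}. y i \<in> Y i) \<and> image_mset y (mset_set {..<d}) \<in> nodec P D" for d :: nat and Y y
  have "\<exists>y. selects (deg G v) (Y G a v) y" if "id_graph G a" "v \<in> verts G" for G a v
    using solves_nodec[OF Y that] by (simp add: nodec_half_iff selects_def)
  moreover have "selects d f = selects d g" if "\<And>i. i < d \<Longrightarrow> f i = g i" for d f g
    using that by (simp add: selects_def fun_eq_iff)
  ultimately obtain y where det': "order_determined (node_view (Suc k)) y"
    and y: "\<And>G a v. id_graph G a \<Longrightarrow> v \<in> verts G \<Longrightarrow> selects (deg G v) (Y G a v) (y G a v)"
    using order_determined_node_choice[OF det, of selects] by blast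
  have mem: "y G a v i \<in> Y G a v i" if "id_port G a v i" for G a v i
    using y that by (auto simp: selects_def id_port_def)
  have "solves P D y"
  proof (rule solvesI)
    fix G a v i assume port: "id_port G a v i"
    show "y G a v i \<in> outs P D"
      using mem[OF port] solves_outs[OF Y port] by auto
    show "{#y G a v i, y G a (nbr G v i) (backport G v i)#} \<in> edgec P D"
      using mem[OF port] mem[OF id_port_swap[OF port]] solves_edgec[OF Y port]
      by (simp add: edgec_half_iff allcomp_def)
  qed (use y in \<open>simp add: selects_def\<close>)
  with det' show ?thesis
    by (auto simp: solvable_def)
qed

text \<open>Both endpoints know the identifiers of both, so they agree on which of them takes the first
  component.\<close>
definition edge_choice ::
    "'o lcl_problem \<Rightarrow> nat \<Rightarrow> ('v, 'l, 'o set) port_assignment \<Rightarrow> ('v, 'l, 'o) port_assignment" where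
  "edge_choice Q D out G a v i =
     (let u = nbr G v i; Y = out G a v i; Z = out G a u (backport G v i)
      in if a v < a u then fst (compatible_pair Q D Y Z) else snd (compatible_pair Q D Z Y))"

lemma order_determined_edge_choice:
  assumes det: "order_determined (node_view k) out"
  shows "order_determined (epview k) (edge_choice Q D out)"
  unfolding order_determined_def
proof (intro allI impI)
  fix G a v G' a' v' i
  assume ports: "id_port G a v i" "id_port G' a' v' i"
    and equiv: "order_equiv (epview k G a v i) (epview k G' a' v' i)"
  have "backport G v i = backport G' v' i"
    using equiv by (rule backport_eq_of_order_equiv)
  moreover have "out G a v i = out G' a' v' i"
    using order_determinedD[OF det ports] order_equiv_pview_of_epview[OF equiv] by simp
  moreover have "out G a (nbr G v i) (backport G v i) = out G' a' (nbr G' v' i) (backport G' v' i)"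
    using order_determinedD[OF det id_port_swap[OF ports(1)]] id_port_swap[OF ports(2)]
      order_equiv_epview_id_port_swap[OF ports equiv] order_equiv_pview_of_epview
    by (metis \<open>backport G v i = backport G' v' i\<close>)
  ultimately show "edge_choice Q D out G a v i = edge_choice Q D out G' a' v' i"
    using endpoint_less_iff_of_order_equiv[OF equiv] by (simp add: edge_choice_def Let_def)
qed

lemma
  assumes "solves (one_from Q) D out" and port: "id_port G a v i"
  shows edge_choice_mem: "edge_choice Q D out G a v i \<in> out G a v i"
    and edge_choice_edgec:
      "{#edge_choice Q D out G a v i, edge_choice Q D out G a (nbr G v i) (backport G v i)#}
      \<in> edgec Q D"
proof -
  let ?u = "nbr G v i" and ?j = "backport G v i"
  have edge: "{#out G a v i, out G a ?u ?j#} \<in> edgec (one_from Q) D"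
    using assms by (rule solves_edgec)
  have "?u \<in> verts G" "?u \<noteq> v" "v \<in> verts G" "inj_on a (verts G)"
    using id_portD[OF port] id_portD[OF id_port_swap[OF port]]
      port_graph.nbr_neq[OF id_portD(2-4)[OF port]] by (auto simp: id_graph_def)
  then have "a v \<noteq> a ?u"
    by (auto dest: inj_onD)
  moreover have "{#out G a ?u ?j, out G a v i#} \<in> edgec (one_from Q) D"
    using edge by (simp add: add_mset_commute)
  ultimately show "edge_choice Q D out G a v i \<in> out G a v i"
    and "{#edge_choice Q D out G a v i, edge_choice Q D out G a ?u ?j#} \<in> edgec Q D"
    using compatible_pair_compatible[OF edge]
      compatible_pair_compatible[of "out G a ?u ?j" "out G a v i"]
    by (auto simp: edge_choice_def Let_def add_mset_commute id_port_swap_swap[OF port])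
qed

lemma solvable_of_solvable_one_from:
  assumes "solvable (node_view k) (one_from Q) D"
  shows "solvable (epview k) Q D"
proof -
  obtain out where det: "order_determined (node_view k) out" and out: "solves (one_from Q) D out"
    using assms by (auto simp: solvable_def)
  have "solves Q D (edge_choice Q D out)"
  proof (rule solvesI)
    fix G a v i assume port: "id_port G a v i"
    show "edge_choice Q D out G a v i \<in> outs Q D"
      using edge_choice_mem[OF out port] solves_outs[OF out port] by auto
    show "{#edge_choice Q D out G a v i,
        edge_choice Q D out G a (nbr G v i) (backport G v i)#} \<in> edgec Q D"
      using edge_choice_edgec[OF out port] .
  next
    fix G a v assume "id_graph G a" "v \<in> verts G"
    then show "image_mset (edge_choice Q D out G a v) (mset_set {..<deg G v}) \<in> nodec Q D"
      using solves_nodec[OF out] edge_choice_mem[OF out]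
      by (simp add: nodec_one_from_iff allnode_iff id_port_def)
  qed
  with order_determined_edge_choice[OF det] show ?thesis
    by (auto simp: solvable_def)
qed

lemma solvable_one_of_solvable_one':
  assumes "solvable (node_view k) (one' P) D"
  shows "solvable (node_view k) (one P) D"
proof -
  have "outs (one' P) D = outs (one P) D"
    by (simp add: one'_def one_def)
  moreover have "nodec (one' P) D \<subseteq> nodec (one P) D"
    using nodec_one'_iff by blast
  moreover have "edgec (one' P) D \<subseteq> edgec (one P) D"
    using edgec_half'_subset[of P D] by (fastforce simp: one'_def one_def one_from_def)
  ultimately have "solves (one P) D out" if "solves (one' P) D out" for out
    using that by (auto simp: solves_def valid_output_def)
  then show ?thesis
    using assms by (auto simp: solvable_def)
qed

lemma order_determined_maximal_completion:
  assumes fin: "finite (outs Q D)" and det: "order_determined (node_view k) Y"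
    and Y: "solves (one_from Q) D Y"
  obtains Z where "order_determined (node_view k) Z"
    "\<And>G a v i. id_port G a v i \<Longrightarrow> Y G a v i \<subseteq> Z G a v i"
    "\<And>G a v i. id_port G a v i \<Longrightarrow> Z G a v i \<subseteq> outs Q D"
    "\<And>G a v. id_graph G a \<Longrightarrow> v \<in> verts G \<Longrightarrow>
      maximal_allnode Q D (image_mset (Z G a v) (mset_set {..<deg G v}))"
proof -
  define completes where "completes d Y Z \<longleftrightarrow> (\<forall>i\<in>{..<d}. Y i \<subseteq> Z i \<and> Z i \<subseteq> outs Q D) \<and>
    maximal_allnode Q D (image_mset Z (mset_set {..<d}))" for d :: nat and Y Z
  have "\<exists>Z. completes (deg G v) (Y G a v) Z" if "id_graph G a" "v \<in> verts G" for G a v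
  proof -
    have "\<forall>i\<in>{..<deg G v}. Y G a v i \<subseteq> outs Q D"
      and "allnode Q D (image_mset (Y G a v) (mset_set {..<deg G v}))"
      using solves_nodec[OF Y that] by (auto simp: nodec_one_from_iff)
    then show ?thesis
      unfolding completes_def by (metis maximal_allnode_completion[OF fin finite_lessThan])
  qed
  moreover have "completes d f = completes d g" if "\<And>i. i < d \<Longrightarrow> f i = g i" for d f g
    using that by (simp add: completes_def fun_eq_iff)
  ultimately obtain Z where det': "order_determined (node_view k) Z"
    and Z: "\<And>G a v. id_graph G a \<Longrightarrow> v \<in> verts G \<Longrightarrow> completes (deg G v) (Y G a v) (Z G a v)"
    using order_determined_node_choice[OF det, of completes] by blast
  have enlarged: "Y G a v i \<subseteq> Z G a v i" "Z G a v i \<subseteq> outs Q D" if "id_port G a v i" for G a v i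
    using Z[of G a v] that by (auto simp: completes_def id_port_def)
  have maximal: "maximal_allnode Q D (image_mset (Z G a v) (mset_set {..<deg G v}))"
    if "id_graph G a" "v \<in> verts G" for G a v
    using Z[OF that] by (simp add: completes_def)
  show thesis
    by (rule that[of Z]) (fact det' enlarged maximal)+
qed

text \<open>No communication is needed: each node enlarges its own outputs to a maximal choice.  Such a
  choice is closed under supersets, so it contains the maximal pairs required on the edges.\<close>
lemma solvable_one'_of_solvable_one:
  assumes fin: "finite (outs P D)" and "solvable (node_view k) (one P) D"
  shows "solvable (node_view k) (one' P) D"
proof -
  obtain Y where det: "order_determined (node_view k) Y" and Y: "solves (one_from (half P)) D Y"
    using assms(2) unfolding solvable_def one_def by blast
  have "finite (outs (half P) D)"
    using fin by simp
  from order_determined_maximal_completion[OF this det Y]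
  obtain Z where det': "order_determined (node_view k) Z"
    and enlarged: "\<And>G a v i. id_port G a v i \<Longrightarrow> Y G a v i \<subseteq> Z G a v i"
    and Z_subset: "\<And>G a v i. id_port G a v i \<Longrightarrow> Z G a v i \<subseteq> Pow (outs P D)"
    and maximal: "\<And>G a v. id_graph G a \<Longrightarrow> v \<in> verts G \<Longrightarrow>
      maximal_allnode (half P) D (image_mset (Z G a v) (mset_set {..<deg G v}))"
    unfolding outs_half by blast
  have upward_closed: "y' \<in> Z G a v i"
    if "id_port G a v i" "y \<in> Z G a v i" "y \<subseteq> y'" "y' \<subseteq> outs P D" for G a v i y y'
  proof (rule maximal_allnode_upward_closed)
    show "maximal_allnode (half P) D (image_mset (Z G a v) (mset_set {..<deg G v}))"
      using maximal that(1) by (simp add: id_port_def)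
    show "Z G a v i \<in># image_mset (Z G a v) (mset_set {..<deg G v})"
      using that(1) by (simp add: id_port_def)
  qed (use that Z_subset in blast)+
  have "solves (one' P) D Z"
  proof (rule solvesI)
    fix G a v i assume port: "id_port G a v i"
    note swap = id_port_swap[OF port]
    show "Z G a v i \<in> outs (one' P) D"
      using Z_subset[OF port] by (simp add: one'_def)
    show "{#Z G a v i, Z G a (nbr G v i) (backport G v i)#} \<in> edgec (one' P) D"
      using edgec_one'_of_edgec_one[OF solves_edgec[OF Y port, folded one_def]
          enlarged[OF port] Z_subset[OF port] upward_closed[OF port]
          enlarged[OF swap] Z_subset[OF swap] upward_closed[OF swap]] .
  next
    fix G a v assume "id_graph G a" "v \<in> verts G"
    then show "image_mset (Z G a v) (mset_set {..<deg G v}) \<in> nodec (one' P) D"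
      using solves_nodec[OF Y] maximal[of G a v] Z_subset
      by (simp add: nodec_one'_iff one_def nodec_one_from_iff maximal_allnode_def id_port_def)
  qed
  with det' show ?thesis
    by (auto simp: solvable_def)
qed

end

section \<open>Speeding up on independent classes\<close>

locale independent_class = id_graph_class C S for C :: "('v, 'l) pgraph set" and S +
  fixes D k :: nat
  assumes deg_le: "G \<in> C \<Longrightarrow> v \<in> verts G \<Longrightarrow> deg G v \<le> D"
    and girth: "G \<in> C \<Longrightarrow> girth_ge G (2 * k + 4)"
    and finite_verts: "G \<in> C \<Longrightarrow> finite (verts G)"
    and card_verts_eq: "G \<in> C \<Longrightarrow> H \<in> C \<Longrightarrow> card (verts G) = card (verts H)"
    and finite_ids: "finite S"
    and independent: "t_independent C (Suc k)"
begin

lemma card_verts_le_card_ids: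
  assumes "id_graph G a" "H \<in> C"
  shows "card (verts H) \<le> card S"
  using assms card_inj_on_le[of a "verts G" S] card_verts_eq[of G H] finite_ids
  by (auto simp: id_graph_def)

lemma relabel_pview:
  assumes H: "H \<in> C" "w \<in> verts H" and G: "id_graph G a" "v \<in> verts G"
    and shape: "nview (Suc k) H w = nview (Suc k) G v"
  obtains \<rho> where "pview (Suc k) H \<rho> w None = pview (Suc k) G a v None"
    "inj_on \<rho> (pview_verts (Suc k) H w None)"
proof (rule relabel_view)
  let ?V = "pview (Suc k) H (\<lambda>x. x) w None" and ?W = "pview (Suc k) G a v None"
  show "map_view (\<lambda>_. ()) id ?V = map_view (\<lambda>_. ()) id ?W"
    using shape by (simp add: nview_def map_view_pview comp_def)
  show "distinct (labels ?V)"
    using H by (intro port_graph.distinct_labels_pview[OF port_graph girth]) auto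
  show "distinct (labels ?W)"
    using G
    by (intro port_graph.distinct_labels_pview[OF port_graph girth]) (auto simp: id_graph_def)
qed (use that in \<open>simp add: map_view_pview comp_def pview_verts_def\<close>)

lemma relabel_epview:
  assumes H: "H \<in> C" "w \<in> verts H" "i < deg H w" and port: "id_port G a v i"
    and shape: "epview k H (\<lambda>_. ()) w i = epview k G (\<lambda>_. ()) v i"
  obtains \<rho> where "epview k H \<rho> w i = epview k G a v i" "inj_on \<rho> (epview_verts k H w i)"
proof (rule relabel_view)
  let ?V = "epview k H (\<lambda>x. x) w i" and ?W = "epview k G a v i"
  show "map_view (\<lambda>_. ()) id ?V = map_view (\<lambda>_. ()) id ?W"
    using shape by (simp add: map_view_epview comp_def)
  show "distinct (labels ?V)"
    using H by (intro port_graph.distinct_labels_epview[OF port_graph girth]) auto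
  show "distinct (labels ?W)"
    using id_portD[OF port]
    by (intro port_graph.distinct_labels_epview[OF port_graph girth]) (auto simp: id_graph_def)
qed (use that in \<open>simp add: map_view_epview comp_def set1_view_epview\<close>)

lemma independent_edge:
  assumes "G\<^sub>1 \<in> C" "v\<^sub>1 \<in> verts G\<^sub>1" "i < deg G\<^sub>1 v\<^sub>1" and "G\<^sub>2 \<in> C" "v\<^sub>2 \<in> verts G\<^sub>2" "i < deg G\<^sub>2 v\<^sub>2"
    and "epview k G\<^sub>1 (\<lambda>_. ()) v\<^sub>1 i = epview k G\<^sub>2 (\<lambda>_. ()) v\<^sub>2 i"
  obtains H w where "H \<in> C" "w \<in> verts H" "i < deg H w"
    "nview (Suc k) H w = nview (Suc k) G\<^sub>1 v\<^sub>1"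
    "nview (Suc k) H (nbr H w i) = nview (Suc k) G\<^sub>2 (nbr G\<^sub>2 v\<^sub>2 i)"
  using independent[unfolded t_independent_def, THEN conjunct1] assms
  unfolding edge_view_Suc_eq_iff by metis

lemma independent_node:
  assumes "G \<in> C" "v \<in> verts G"
    and "\<And>i. i < deg G v \<Longrightarrow> Gs i \<in> C \<and> vs i \<in> verts (Gs i) \<and> nview k (Gs i) (vs i) = nview k G v"
  obtains H w where "H \<in> C" "w \<in> verts H" "deg H w = deg G v"
    "\<And>i. i < deg G v \<Longrightarrow> epview k H (\<lambda>_. ()) w i = epview k (Gs i) (\<lambda>_. ()) (vs i) i"
proof -
  obtain H w where "H \<in> C" "w \<in> verts H" and "nview k H w = nview k G v"
    and "\<forall>i<deg G v. edge_view (Suc k) H w i = edge_view (Suc k) (Gs i) (vs i) i"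
    using independent[unfolded t_independent_def, THEN conjunct2, rule_format, of G v Gs vs] assms
    by auto
  moreover from this(3) have "deg H w = deg G v"
    unfolding nview_def by (rule pview_eq_imp_deg_eq)
  ultimately show thesis
    using that by (simp add: edge_view_Suc_eq_iff)
qed

lemma amalgamate_edge_labels:
  assumes H: "H \<in> C" "w \<in> verts H" "i < deg H w" and card: "card (verts H) \<le> card S"
    and inj: "inj_on \<rho>\<^sub>1 (pview_verts (Suc k) H w None)"
      "inj_on \<rho>\<^sub>2 (pview_verts (Suc k) H (nbr H w i) None)"
    and agree: "order_equiv (epview k H \<rho>\<^sub>1 w i) (epview k H \<rho>\<^sub>2 w i)"
  obtains b where "id_port H b w i"
    "order_equiv (pview (Suc k) H \<rho>\<^sub>1 w None) (pview (Suc k) H b w None)"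
    "order_equiv (pview (Suc k) H \<rho>\<^sub>2 (nbr H w i) None) (pview (Suc k) H b (nbr H w i) None)"
proof -
  interpret H: port_graph H
    using port_graph H(1) .
  let ?X\<^sub>1 = "pview_verts (Suc k) H w None" and ?X\<^sub>2 = "pview_verts (Suc k) H (nbr H w i) None"
  have "same_order (?X\<^sub>1 \<inter> ?X\<^sub>2) \<rho>\<^sub>1 \<rho>\<^sub>2"
    using agree H.pview_verts_inter_nbr[OF girth[OF H(1)] H(2,3) order_refl]
    by (simp add: order_equiv_epview_iff)
  then obtain b where "inj_on b (verts H)" "b ` verts H \<subseteq> S"
    and "same_order ?X\<^sub>1 \<rho>\<^sub>1 b" "same_order ?X\<^sub>2 \<rho>\<^sub>2 b"
    using amalgamate_two_orders[OF finite_verts[OF H(1)] H.pview_verts_subset_verts[OF H(2)]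
        H.pview_verts_subset_verts[OF H.nbr_in_verts[OF H(2,3)]] inj _ finite_ids card] by blast
  then show thesis
    using that H by (simp add: order_equiv_pview_iff id_port_def id_graph_def)
qed

lemma amalgamate_node_labels:
  assumes H: "H \<in> C" "w \<in> verts H" and card: "card (verts H) \<le> card S"
    and inj: "\<And>i. i < deg H w \<Longrightarrow> inj_on (\<rho> i) (epview_verts k H w i)"
    and agree: "\<And>i l. i < deg H w \<Longrightarrow> l < deg H w \<Longrightarrow>
      order_equiv (pview k H (\<rho> i) w None) (pview k H (\<rho> l) w None)"
  obtains b where "id_graph H b"
    "\<And>i. i < deg H w \<Longrightarrow> order_equiv (epview k H (\<rho> i) w i) (epview k H b w i)"
proof -
  interpret H: port_graph H
    using port_graph H(1) .
  let ?X = "epview_verts k H w" and ?Y = "pview_verts k H w None" and ?I = "{..<deg H w}"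
  have "inj_on (\<rho> i) (?X i)" "?X i \<subseteq> verts H" if "i \<in> ?I" for i
    using inj H.epview_verts_subset_verts[OF H(2)] that by simp_all
  moreover have "same_order ?Y (\<rho> i) (\<rho> l)" if "i \<in> ?I" "l \<in> ?I" for i l
    using agree that by (simp add: order_equiv_pview_iff)
  moreover have "?X i \<inter> ?X l \<subseteq> ?Y" if "i \<in> ?I" "l \<in> ?I" "i \<noteq> l" for i l
    using H.epview_verts_inter[OF girth[OF H(1)] H(2)] that by simp
  ultimately obtain b where "inj_on b (verts H)" "b ` verts H \<subseteq> S"
    and "\<And>i. i \<in> ?I \<Longrightarrow> same_order (?X i) (\<rho> i) b"
    using amalgamate_sunflower_orders[where I = ?I and X = ?X and Y = ?Y and a = \<rho>,
        OF finite_verts[OF H(1)] _ H.pview_verts_subset_verts[OF H(2)] _ _ _ finite_ids card]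
    by blast
  then show thesis
    using that H(1) by (simp add: order_equiv_epview_iff id_graph_def)
qed

lemma edge_extensions_realized:
  assumes ports: "id_port G\<^sub>1 a\<^sub>1 v\<^sub>1 i" "id_port G\<^sub>2 a\<^sub>2 v\<^sub>2 i"
    and equiv: "order_equiv (epview k G\<^sub>1 a\<^sub>1 v\<^sub>1 i) (epview k G\<^sub>2 a\<^sub>2 v\<^sub>2 i)"
  obtains H b w where "id_port H b w i"
    "order_equiv (pview (Suc k) G\<^sub>1 a\<^sub>1 v\<^sub>1 None) (pview (Suc k) H b w None)"
    "order_equiv (pview (Suc k) G\<^sub>2 a\<^sub>2 (nbr G\<^sub>2 v\<^sub>2 i) None) (pview (Suc k) H b (nbr H w i) None)"
proof -
  let ?u\<^sub>2 = "nbr G\<^sub>2 v\<^sub>2 i"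
  note port\<^sub>1 = id_portD[OF ports(1)] and port\<^sub>2 = id_portD[OF ports(2)]
  have "epview k G\<^sub>1 (\<lambda>_. ()) v\<^sub>1 i = epview k G\<^sub>2 (\<lambda>_. ()) v\<^sub>2 i"
    using order_equiv_imp_same_shape[OF equiv] by (simp add: map_view_epview comp_def)
  then obtain H w where H: "H \<in> C" "w \<in> verts H" "i < deg H w"
    and shapes: "nview (Suc k) H w = nview (Suc k) G\<^sub>1 v\<^sub>1"
      "nview (Suc k) H (nbr H w i) = nview (Suc k) G\<^sub>2 ?u\<^sub>2"
    using independent_edge port\<^sub>1 port\<^sub>2 by (metis id_graph_def)
  let ?u = "nbr H w i"
  have u: "?u \<in> verts H"
    using port_graph.nbr_in_verts[OF port_graph] H by blast
  obtain \<rho>\<^sub>1 where \<rho>\<^sub>1: "pview (Suc k) H \<rho>\<^sub>1 w None = pview (Suc k) G\<^sub>1 a\<^sub>1 v\<^sub>1 None"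
      "inj_on \<rho>\<^sub>1 (pview_verts (Suc k) H w None)"
    using relabel_pview[OF H(1,2) port\<^sub>1(1,3) shapes(1)] .
  obtain \<rho>\<^sub>2 where \<rho>\<^sub>2: "pview (Suc k) H \<rho>\<^sub>2 ?u None = pview (Suc k) G\<^sub>2 a\<^sub>2 ?u\<^sub>2 None"
      "inj_on \<rho>\<^sub>2 (pview_verts (Suc k) H ?u None)"
    using relabel_pview[OF H(1) u _ _ shapes(2)] id_portD(1,3)[OF id_port_swap[OF ports(2)]]
    by blast
  have edge\<^sub>1: "epview k H \<rho>\<^sub>1 w i = epview k G\<^sub>1 a\<^sub>1 v\<^sub>1 i"
    using \<rho>\<^sub>1(1) H(3) by (rule epview_eq_of_pview_eq)
  then have "backport H w i = backport G\<^sub>2 v\<^sub>2 i"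
    using backport_eq_of_order_equiv[OF equiv] by (simp add: epview_def)
  then have edge\<^sub>2: "epview k H \<rho>\<^sub>2 w i = epview k G\<^sub>2 a\<^sub>2 v\<^sub>2 i"
    using epview_eq_of_pview_nbr_eq[OF port_graph[OF H(1)] port\<^sub>2(2) H(2,3) port\<^sub>2(3,4) _ \<rho>\<^sub>2(1)]
    by simp
  obtain b where "id_port H b w i"
    "order_equiv (pview (Suc k) H \<rho>\<^sub>1 w None) (pview (Suc k) H b w None)"
    "order_equiv (pview (Suc k) H \<rho>\<^sub>2 ?u None) (pview (Suc k) H b ?u None)"
    by (rule amalgamate_edge_labels[OF H card_verts_le_card_ids[OF port\<^sub>1(1) H(1)] \<rho>\<^sub>1(2) \<rho>\<^sub>2(2)
          equiv[folded edge\<^sub>1 edge\<^sub>2]])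
  then show thesis
    using that unfolding \<rho>\<^sub>1(1) \<rho>\<^sub>2(1) by blast
qed

lemma node_extensions_realized:
  assumes G: "id_graph G a" "v \<in> verts G"
    and ports: "\<And>i. i < deg G v \<Longrightarrow> id_port (Gs i) (as i) (vs i) i"
    and equiv: "\<And>i. i < deg G v \<Longrightarrow>
      order_equiv (pview k G a v None) (pview k (Gs i) (as i) (vs i) None)"
  obtains H b w where "id_graph H b" "w \<in> verts H" "deg H w = deg G v"
    "\<And>i. i < deg G v \<Longrightarrow> order_equiv (epview k (Gs i) (as i) (vs i) i) (epview k H b w i)"
proof -
  have "G \<in> C"
    using G(1) by (simp add: id_graph_def)
  have "Gs i \<in> C \<and> vs i \<in> verts (Gs i) \<and> nview k (Gs i) (vs i) = nview k G v" if "i < deg G v" for i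
    using id_portD[OF ports[OF that]] nview_eq_of_order_equiv[OF equiv[OF that]]
    by (simp add: id_graph_def)
  then obtain H w where H: "H \<in> C" "w \<in> verts H" "deg H w = deg G v"
      and shapes: "\<And>i. i < deg G v \<Longrightarrow> epview k H (\<lambda>_. ()) w i = epview k (Gs i) (\<lambda>_. ()) (vs i) i"
    using independent_node[OF \<open>G \<in> C\<close> G(2)] by blast
  have "\<exists>\<rho>. epview k H \<rho> w i = epview k (Gs i) (as i) (vs i) i \<and> inj_on \<rho> (epview_verts k H w i)"
    if "i < deg G v" for i
    using relabel_epview[OF H(1,2) _ ports[OF that] shapes[OF that]] that H(3) by metis
  then obtain \<rho> where \<rho>: "\<And>i. i < deg G v \<Longrightarrow> epview k H (\<rho> i) w i = epview k (Gs i) (as i) (vs i) i"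
      and inj: "\<And>i. i < deg G v \<Longrightarrow> inj_on (\<rho> i) (epview_verts k H w i)"
    by metis
  have "order_equiv (pview k H (\<rho> i) w None) (pview k H (\<rho> l) w None)"
    if "i < deg G v" "l < deg G v" for i l
    unfolding pview_eq_of_epview_eq[OF \<rho>[OF that(1)]] pview_eq_of_epview_eq[OF \<rho>[OF that(2)]]
    using order_equiv_trans[OF order_equiv_sym[OF equiv] equiv] that by blast
  then obtain b where "id_graph H b"
    and "\<And>i. i < deg G v \<Longrightarrow> order_equiv (epview k H (\<rho> i) w i) (epview k H b w i)"
    using amalgamate_node_labels[OF H(1,2) card_verts_le_card_ids[OF G(1) H(1)], of \<rho>] inj
    unfolding H(3) by blast
  then show thesis
    using that[OF _ H(2,3)] by (simp add: \<rho>)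
qed

lemma possible_outputs_compatible:
  assumes det: "order_determined (node_view (Suc k)) out" and out: "solves P D out"
    and port: "id_port G a v i"
  shows "allcomp P D (possible_outputs (epview k) out G a v i)
    (possible_outputs (epview k) out G a (nbr G v i) (backport G v i))"
  unfolding allcomp_def
proof (intro ballI)
  fix x y
  assume "x \<in> possible_outputs (epview k) out G a v i"
  then obtain G\<^sub>1 a\<^sub>1 v\<^sub>1 where x: "id_port G\<^sub>1 a\<^sub>1 v\<^sub>1 i" "x = out G\<^sub>1 a\<^sub>1 v\<^sub>1 i"
      "order_equiv (epview k G a v i) (epview k G\<^sub>1 a\<^sub>1 v\<^sub>1 i)"
    by (auto simp: possible_outputs_def)
  assume "y \<in> possible_outputs (epview k) out G a (nbr G v i) (backport G v i)"
  with port obtain G\<^sub>2 a\<^sub>2 v\<^sub>2 where y: "id_port G\<^sub>2 a\<^sub>2 v\<^sub>2 i"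
      "y = out G\<^sub>2 a\<^sub>2 (nbr G\<^sub>2 v\<^sub>2 i) (backport G\<^sub>2 v\<^sub>2 i)"
      "order_equiv (epview k G a v i) (epview k G\<^sub>2 a\<^sub>2 v\<^sub>2 i)"
    by (rule possible_outputs_across_edge)
  have equiv: "order_equiv (epview k G\<^sub>1 a\<^sub>1 v\<^sub>1 i) (epview k G\<^sub>2 a\<^sub>2 v\<^sub>2 i)"
    using order_equiv_sym[OF x(3)] y(3) by (rule order_equiv_trans)
  obtain H b w where H: "id_port H b w i"
      and near: "order_equiv (pview (Suc k) G\<^sub>1 a\<^sub>1 v\<^sub>1 None) (pview (Suc k) H b w None)"
      and far: "order_equiv (pview (Suc k) G\<^sub>2 a\<^sub>2 (nbr G\<^sub>2 v\<^sub>2 i) None)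
        (pview (Suc k) H b (nbr H w i) None)"
    by (rule edge_extensions_realized[OF x(1) y(1) equiv])
  have "order_equiv (epview k G\<^sub>1 a\<^sub>1 v\<^sub>1 i) (epview k H b w i)"
    using near id_portD(4)[OF x(1)] by (rule order_equiv_epview_of_pview)
  then have port_eq: "backport G\<^sub>2 v\<^sub>2 i = backport H w i"
    using backport_eq_of_order_equiv equiv by metis
  have "x = out H b w i"
    using order_determinedD[OF det x(1) H near] x(2) by simp
  moreover have "y = out H b (nbr H w i) (backport H w i)"
    using order_determinedD[OF det id_port_swap[OF y(1)] _ far] id_port_swap[OF H] y(2)
    by (simp add: port_eq)
  ultimately show "{#x, y#} \<in> edgec P D"
    using solves_edgec[OF out H] by simp
qed

lemma solvable_half_of_solvable:
  assumes "solvable (node_view (Suc k)) P D"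
  shows "solvable (epview k) (half P) D"
proof -
  obtain out where det: "order_determined (node_view (Suc k)) out" and out: "solves P D out"
    using assms by (auto simp: solvable_def)
  have "solves (half P) D (possible_outputs (epview k) out)"
  proof (rule solvesI)
    fix G a v i assume port: "id_port G a v i"
    show "possible_outputs (epview k) out G a v i \<in> outs (half P) D"
      using possible_outputs_subset[OF out] by simp
    show "{#possible_outputs (epview k) out G a v i,
        possible_outputs (epview k) out G a (nbr G v i) (backport G v i)#} \<in> edgec (half P) D"
      using possible_outputs_subset[OF out] possible_outputs_compatible[OF det out port]
      by (simp add: edgec_half_iff)
  next
    fix G a v assume v: "id_graph G a" "v \<in> verts G"
    then have "\<forall>i\<in>{..<deg G v}. out G a v i \<in> possible_outputs (epview k) out G a v i"
      by (intro ballI output_in_possible_outputs) (simp add: id_port_def)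
    moreover have "deg G v \<le> D"
      using deg_le v by (simp add: id_graph_def)
    ultimately show "image_mset (possible_outputs (epview k) out G a v) (mset_set {..<deg G v})
        \<in> nodec (half P) D"
      using solves_nodec[OF out v] possible_outputs_subset[OF out]
      unfolding nodec_half_iff[OF finite_lessThan] card_lessThan by blast
  qed
  with order_determined_possible_outputs show ?thesis
    by (auto simp: solvable_def)
qed

lemma allnode_possible_outputs:
  assumes det: "order_determined (epview k) out" and out: "solves Q D out"
    and v: "id_graph G a" "v \<in> verts G"
  shows "allnode Q D
    (image_mset (possible_outputs (node_view k) out G a v) (mset_set {..<deg G v}))"
  unfolding allnode_iff[OF finite_lessThan]
proof (intro allI impI)
  let ?d = "deg G v"
  fix y assume "\<forall>i\<in>{..<?d}. y i \<in> possible_outputs (node_view k) out G a v i"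
  then have "\<forall>i\<in>{..<?d}. \<exists>H b w. y i = out H b w i \<and> id_port H b w i \<and>
      order_equiv (pview k G a v None) (pview k H b w None)"
    by (simp add: possible_outputs_def)
  then obtain Gs as vs where extension: "\<And>i. i < ?d \<Longrightarrow> y i = out (Gs i) (as i) (vs i) i"
      "\<And>i. i < ?d \<Longrightarrow> id_port (Gs i) (as i) (vs i) i"
      "\<And>i. i < ?d \<Longrightarrow> order_equiv (pview k G a v None) (pview k (Gs i) (as i) (vs i) None)"
    by (metis lessThan_iff)
  obtain H b w where H: "id_graph H b" "w \<in> verts H" "deg H w = ?d"
      and equiv: "\<And>i. i < ?d \<Longrightarrow> order_equiv (epview k (Gs i) (as i) (vs i) i) (epview k H b w i)"
    using node_extensions_realized[OF v extension(2,3)] by blast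
  have "y i = out H b w i" if "i < ?d" for i
    using order_determinedD[OF det extension(2)[OF that] _ equiv[OF that]] extension(1)[OF that]
      H that by (simp add: id_port_def)
  then have "image_mset y (mset_set {..<?d}) = image_mset (out H b w) (mset_set {..<deg H w})"
    unfolding H(3) by (intro image_mset_cong) simp
  then show "image_mset y (mset_set {..<?d}) \<in> nodec Q D"
    using solves_nodec[OF out H(1,2)] by simp
qed

lemma solvable_one_from_of_solvable:
  assumes "solvable (epview k) Q D"
  shows "solvable (node_view k) (one_from Q) D"
proof -
  obtain out where det: "order_determined (epview k) out" and out: "solves Q D out"
    using assms by (auto simp: solvable_def)
  have "solves (one_from Q) D (possible_outputs (node_view k) out)"
  proof (rule solvesI)
    fix G a v i assume port: "id_port G a v i"
    show "possible_outputs (node_view k) out G a v i \<in> outs (one_from Q) D"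
      using possible_outputs_subset[OF out] by simp
    show "{#possible_outputs (node_view k) out G a v i,
        possible_outputs (node_view k) out G a (nbr G v i) (backport G v i)#}
        \<in> edgec (one_from Q) D"
      unfolding edgec_one_from_iff
      using possible_outputs_subset[OF out] solves_edgec[OF out port]
        output_in_possible_outputs port id_port_swap[OF port] by meson
  next
    fix G a v assume v: "id_graph G a" "v \<in> verts G"
    then show "image_mset (possible_outputs (node_view k) out G a v) (mset_set {..<deg G v})
        \<in> nodec (one_from Q) D"
      using allnode_possible_outputs[OF det out] possible_outputs_subset[OF out] deg_le
      by (simp add: nodec_one_from_iff id_graph_def)
  qed
  with order_determined_possible_outputs show ?thesis
    by (auto simp: solvable_def)
qed

end

section \<open>The speedup theorem\<close>

lemma port_graph_of_in_graph_class: "in_graph_class n D Sig G \<Longrightarrow> port_graph G"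
  unfolding in_graph_class_def port_graph_def by blast

theorem theorem4:
  fixes P :: "'o lcl_problem"
    and C :: "('v, 'l) pgraph set"
    and Sig :: "'l set"
    and n D t :: nat
    and S :: "nat set"
  assumes "wf_problem P"
    and "finite Sig"
    and "\<forall>G\<in>C. in_graph_class n D Sig G"
    and "t > 0"
    and "t_independent C t"
    and "\<forall>G\<in>C. girth_ge G (2 * t + 2)"
    and "finite S" and "0 \<notin> S"
    and "card S \<ge> 4 * D ^ (2 * t)"
  shows "((\<exists>A :: (nat, 'l) view \<Rightarrow> nat \<Rightarrow> 'o.
              order_invariant A \<and> solves_with_ids P D A t C S)
          \<longleftrightarrow> (\<exists>A :: (nat, 'l) view \<Rightarrow> nat \<Rightarrow> 'o set set.
              order_invariant A \<and> solves_with_ids (one P) D A (t - 1) C S))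
       \<and> ((\<exists>A :: (nat, 'l) view \<Rightarrow> nat \<Rightarrow> 'o set set.
              order_invariant A \<and> solves_with_ids (one P) D A (t - 1) C S)
          \<longleftrightarrow> (\<exists>A :: (nat, 'l) view \<Rightarrow> nat \<Rightarrow> 'o set set.
              order_invariant A \<and> solves_with_ids (one' P) D A (t - 1) C S))"
proof -
  obtain k where t: "t = Suc k"
    using assms(4) by (cases t) auto
  interpret independent_class C S D k
    using assms(3,5-7) port_graph_of_in_graph_class
    by unfold_locales (auto simp: t in_graph_class_def numeral_eq_Suc)
  have "solvable (node_view (Suc k)) P D \<longleftrightarrow> solvable (epview k) (half P) D"
    using solvable_half_of_solvable solvable_of_solvable_half by blast
  moreover have "solvable (epview k) (half P) D \<longleftrightarrow> solvable (node_view k) (one P) D"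
    unfolding one_def using solvable_one_from_of_solvable solvable_of_solvable_one_from by blast
  moreover have "finite (outs P D)"
    using assms(1) by (simp add: wf_problem_def)
  then have "solvable (node_view k) (one P) D \<longleftrightarrow> solvable (node_view k) (one' P) D"
    using solvable_one'_of_solvable_one solvable_one_of_solvable_one' by blast
  ultimately show ?thesis
    unfolding t diff_Suc_1 order_invariant_solvable_iff by simp
qed

end
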